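(* Let $\sigma\in\{1212,1221\}$ and let $\tau$ be a matching. Then for every $n\geq 2$, $$|\mathcal{M}_{n}(\sigma(\tau+2))|=C_{n}+\sum_{\ell=2}^{n}\sum_{k=0}^{n-\ell}\binom{2\ell-1}{\ell-2}\binom{2\ell-1+k}{k}\binom{2(n-\ell)-k}{k}\,k!\,|\mathcal{M}_{n-\ell-k}(\tau)|.$$
   Context: A matching of order $n$ is a partition of $[2n]$ into blocks (edges) of size two, identified with the word in $[n]^{2n}$ where both vertices of an edge carry the same letter and letters appear in increasing order of left vertices (so $1212=\{\{1,3\},\{2,4\}\}$, $1221=\{\{1,4\},\{2,3\}\}$). A matching $\sigma$ of order $k$ is a pattern of $\tau$ if there are $i_1<\dots<i_{2k}$ with $\{i_p,i_q\}\in\tau$ iff $\{p,q\}\in\sigma$; otherwise $\tau$ avoids $\sigma$. $\mathcal{M}_n(S)$ is the set of matchings of order $n$ avoiding all patterns in $S$ ($\mathcal{M}_0(S)$ consists of the empty matching). $\sigma(\tau+2)$ is the word of $\sigma$ followed by the word of $\tau$ with $2$ added to each letter (juxtaposition). $C_n=\frac{1}{n+1}\binom{2n}{n}$. *)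

theory Defs
  imports Main
begin

text \<open>Positions are 0-indexed: a matching of order n is a partition of {0..<2n}
  into blocks of size two.\<close>

definition is_matching :: "nat \<Rightarrow> nat set set \<Rightarrow> bool" where
  "is_matching n M \<longleftrightarrow> (\<forall>e\<in>M. card e = 2) \<and> \<Union>M = {0..<2*n}
     \<and> (\<forall>e\<in>M. \<forall>e'\<in>M. e \<noteq> e' \<longrightarrow> e \<inter> e' = {})"

definition contains_pattern :: "nat \<Rightarrow> nat set set \<Rightarrow> nat \<Rightarrow> nat set set \<Rightarrow> bool" where
  "contains_pattern k \<sigma> n \<tau> \<longleftrightarrow>
     (\<exists>f. strict_mono_on {0..<2*k} f \<and> (\<forall>p<2*k. f p < 2*n)
        \<and> (\<forall>p<2*k. \<forall>q<2*k. ({f p, f q} \<in> \<tau> \<longleftrightarrow> {p, q} \<in> \<sigma>)))"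

definition avoiders :: "nat \<Rightarrow> nat \<Rightarrow> nat set set \<Rightarrow> nat set set set" where
  "avoiders n k \<sigma> = {M. is_matching n M \<and> \<not> contains_pattern k \<sigma> n M}"

text \<open>Juxtaposition sigma(tau + k) where sigma has order k: shift positions of tau by 2k.\<close>
definition juxt :: "nat \<Rightarrow> nat set set \<Rightarrow> nat set set \<Rightarrow> nat set set" where
  "juxt k \<sigma> \<tau> = \<sigma> \<union> ((\<lambda>e. (\<lambda>i. i + 2*k) ` e) ` \<tau>)"

definition catalan :: "nat \<Rightarrow> nat" where
  "catalan n = ((2*n) choose n) div (n+1)"

definition m1212 :: "nat set set" where "m1212 = {{0,2},{1,3}}"
definition m1221 :: "nat set set" where "m1221 = {{0,3},{1,2}}"

end

theory Submission
  imports Defs "HOL-Library.Infinite_Set"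
begin

text \<open>
  Suppose that a matching contains \<open>\<sigma>\<close>, and cut it after the shortest prefix that contains \<open>\<sigma>\<close>.  The
  matching avoids \<open>\<sigma>(\<tau>+2)\<close> iff the edges to the right of the cut avoid \<open>\<tau>\<close>.  If the prefix has \<open>2l\<close>
  points matched among themselves and \<open>k\<close> points matched across the cut, then the last point of the
  prefix is of the first kind, so there are \<open>binomial(2l-1+k, k)\<close> ways to place the crossing points,
  \<open>binomial(2(n-l)-k, k)\<close> ways to choose their partners, \<open>k!\<close> ways to join them, and the rest is a
  matching of order \<open>n-l-k\<close> avoiding \<open>\<tau>\<close>.  The prefix itself is a matching of order \<open>l\<close> that contains
  \<open>\<sigma>\<close> but avoids it once the edge at the last point is deleted; as there are \<open>C_l\<close> matchings avoiding
  \<open>\<sigma>\<close>, this leaves \<open>(2l-1) C_(l-1) - C_l = binomial(2l-1, l-2)\<close> choices.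

  Avoiders of 1212 and of 1221 are both counted by building the matching from left to right: each
  closing position must be joined to the last (respectively first) open point, so in both cases the
  number of partial matchings satisfies the ballot recurrence.
\<close>

section \<open>Matchings and patterns\<close>

definition matching :: "nat set set \<Rightarrow> bool" where
  "matching M \<longleftrightarrow> (\<forall>e\<in>M. card e = 2) \<and> (\<forall>e\<in>M. \<forall>e'\<in>M. e \<noteq> e' \<longrightarrow> e \<inter> e' = {})"

text \<open>Arbitrary ground sets are allowed because the pieces of a cut matching live on scattered
  positions.\<close>

definition matchings_on :: "nat set \<Rightarrow> nat set set set" where
  "matchings_on A = {M. matching M \<and> \<Union>M = A}"

definition embeds :: "nat \<Rightarrow> nat set set \<Rightarrow> nat set set \<Rightarrow> bool" where
  "embeds k \<sigma> M \<longleftrightarrow> (\<exists>f. strict_mono_on {0..<2*k} f \<and> (\<forall>e\<in>\<sigma>. f ` e \<in> M))"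

definition avoiders_on :: "nat \<Rightarrow> nat set set \<Rightarrow> nat set \<Rightarrow> nat set set set" where
  "avoiders_on k \<sigma> A = {M \<in> matchings_on A. \<not> embeds k \<sigma> M}"

lemma is_matching_iff: "is_matching n M \<longleftrightarrow> M \<in> matchings_on {0..<2*n}"
  by (auto simp: is_matching_def matchings_on_def matching_def)

lemma matching_edges_eq:
  "matching M \<Longrightarrow> e \<in> M \<Longrightarrow> e' \<in> M \<Longrightarrow> x \<in> e \<Longrightarrow> x \<in> e' \<Longrightarrow> e = e'"
  unfolding matching_def by blast

lemma matching_edgeE:
  assumes "matching M" "e \<in> M" "x \<in> e"
  obtains y where "e = {x, y}" "y \<noteq> x"
proof -
  have "card e = 2" using assms by (auto simp: matching_def)
  then obtain a b where "e = {a, b}" "a \<noteq> b" by (auto simp: card_2_iff)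
  with assms(3) that show thesis by (metis insert_commute insertE singletonD)
qed

lemma matching_card2: "matching M \<Longrightarrow> e \<in> M \<Longrightarrow> card e = 2"
  by (auto simp: matching_def)

lemma matching_subset: "matching M \<Longrightarrow> N \<subseteq> M \<Longrightarrow> matching N"
  unfolding matching_def by blast

lemma card_Union_matching:
  assumes "matching M"
  shows "card (\<Union>M) = 2 * card M"
proof -
  have "card (\<Union>M) = sum card M"
    using assms by (intro card_Union_disjoint)
      (auto simp: matching_def pairwise_def disjnt_def card_ge_0_finite)
  also have "\<dots> = 2 * card M"
    using assms by (simp add: matching_def)
  finally show ?thesis .
qed

lemma finite_matchings_on [simp]: "finite A \<Longrightarrow> finite (matchings_on A)"
  by (rule finite_subset[of _ "Pow (Pow A)"]) (auto simp: matchings_on_def)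

lemma finite_avoiders_on [simp]: "finite A \<Longrightarrow> finite (avoiders_on k \<sigma> A)"
  by (simp add: avoiders_on_def)

lemma embeds_mono: "embeds k \<sigma> M \<Longrightarrow> M \<subseteq> N \<Longrightarrow> embeds k \<sigma> N"
  unfolding embeds_def by blast

text \<open>
  In \<open>embeds\<close> only edges of the pattern are required to map to edges.  For perfect patterns this is
  equivalent to the two-sided condition, and it is monotone in the host.
\<close>

lemma contains_pattern_iff_embeds:
  assumes s: "\<sigma> \<in> matchings_on {0..<2*k}" and M: "M \<in> matchings_on {0..<2*n}"
  shows "contains_pattern k \<sigma> n M \<longleftrightarrow> embeds k \<sigma> M"
proof
  assume "contains_pattern k \<sigma> n M"
  then obtain f where f: "strict_mono_on {0..<2*k} f"
    "\<And>p q. p < 2*k \<Longrightarrow> q < 2*k \<Longrightarrow> {f p, f q} \<in> M \<longleftrightarrow> {p, q} \<in> \<sigma>"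
    unfolding contains_pattern_def by blast
  have "f ` e \<in> M" if "e \<in> \<sigma>" for e
  proof -
    have "card e = 2" using s that by (auto simp: matchings_on_def matching_def)
    then obtain a b where e: "e = {a, b}" by (auto simp: card_2_iff)
    have "a < 2*k" "b < 2*k" using s that e by (auto simp: matchings_on_def)
    then show ?thesis using f(2) that e by auto
  qed
  with f(1) show "embeds k \<sigma> M" unfolding embeds_def by blast
next
  assume "embeds k \<sigma> M"
  then obtain f where f: "strict_mono_on {0..<2*k} f" and fe: "\<And>e. e \<in> \<sigma> \<Longrightarrow> f ` e \<in> M"
    unfolding embeds_def by blast
  have sm: "matching \<sigma>" "\<Union>\<sigma> = {0..<2*k}" and Mm: "matching M" "\<Union>M = {0..<2*n}"
    using s M by (auto simp: matchings_on_def)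
  have bound: "f p < 2*n" if "p < 2*k" for p
  proof -
    have "p \<in> \<Union>\<sigma>" using that sm by simp
    then obtain e where "e \<in> \<sigma>" "p \<in> e" by blast
    then have "f p \<in> \<Union>M" using fe by blast
    then show ?thesis using Mm by simp
  qed
  have "{f p, f q} \<in> M \<longleftrightarrow> {p, q} \<in> \<sigma>" if p: "p < 2*k" and q: "q < 2*k" for p q
  proof
    assume "{p, q} \<in> \<sigma>"
    then show "{f p, f q} \<in> M" using fe[of "{p, q}"] by simp
  next
    assume m: "{f p, f q} \<in> M"
    then have "f p \<noteq> f q" using matching_card2[OF Mm(1) m] by auto
    \<comment> \<open>The pattern is perfect, so \<open>p\<close> has a partner \<open>r\<close>.
      The image of \<open>{p, r}\<close> is the edge at \<open>f p\<close>, which is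
      \<open>{f p, f q}\<close>, and injectivity gives \<open>r = q\<close>.\<close>
    have "p \<in> \<Union>\<sigma>" using p sm by simp
    then obtain e where e: "e \<in> \<sigma>" "p \<in> e" by blast
    then obtain r where r: "e = {p, r}" "r \<noteq> p" using matching_edgeE[OF sm(1)] by metis
    have "r < 2*k" using e r sm by (metis UnionI atLeastLessThan_iff insertCI)
    have "f ` e = {f p, f q}"
      by (rule matching_edges_eq[OF Mm(1) fe m, of _ "f p"]) (use e in auto)
    then have "f r = f q" using r \<open>f p \<noteq> f q\<close> by (auto simp: doubleton_eq_iff)
    then have "r = q"
      using strict_mono_on_imp_inj_on[OF f] \<open>r < 2*k\<close> q by (auto dest: inj_onD)
    then show "{p, q} \<in> \<sigma>" using e r by simp
  qed
  with f bound show "contains_pattern k \<sigma> n M" unfolding contains_pattern_def by blast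
qed

lemma avoiders_eq_avoiders_on:
  assumes "is_matching k \<sigma>"
  shows "avoiders n k \<sigma> = avoiders_on k \<sigma> {0..<2*n}"
  using assms contains_pattern_iff_embeds
  by (auto simp: avoiders_def avoiders_on_def is_matching_iff)

section \<open>Order-preserving relabelling of positions\<close>

lemma matchings_on_image:
  assumes M: "M \<in> matchings_on A" and h: "strict_mono_on A h"
  shows "(`) h ` M \<in> matchings_on (h ` A)"
proof -
  have inj: "inj_on h A" using h by (rule strict_mono_on_imp_inj_on)
  have U: "\<Union>M = A" and m: "matching M" using M by (auto simp: matchings_on_def)
  have sub: "e \<subseteq> A" if "e \<in> M" for e using that U by blast
  have "card (h ` e) = 2" if "e \<in> M" for e
    using that sub m by (simp add: card_image[OF inj_on_subset[OF inj]] matching_def)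
  moreover have "h ` e \<inter> h ` e' = {}" if "e \<in> M" "e' \<in> M" "h ` e \<noteq> h ` e'" for e e'
  proof -
    have "e \<noteq> e'" using that by blast
    then have "e \<inter> e' = {}" using that m unfolding matching_def by blast
    then show ?thesis using inj_on_image_Int[OF inj sub sub] that by (metis image_empty)
  qed
  ultimately show ?thesis
    using U by (auto simp: matchings_on_def matching_def)
qed

lemma embeds_image:
  assumes s: "\<sigma> \<in> matchings_on {0..<2*k}" and M: "M \<in> matchings_on A"
    and h: "strict_mono_on A h" and "embeds k \<sigma> M"
  shows "embeds k \<sigma> ((`) h ` M)"
proof -
  obtain f where f: "strict_mono_on {0..<2*k} f" and fe: "\<And>e. e \<in> \<sigma> \<Longrightarrow> f ` e \<in> M"
    using assms(4) unfolding embeds_def by blast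
  \<comment> \<open>Every position of the pattern lies on an edge, so \<open>f\<close> takes its
    values in \<open>A\<close>, where \<open>h\<close> is monotone.\<close>
  have fA: "f p \<in> A" if "p < 2*k" for p
  proof -
    have "p \<in> \<Union>\<sigma>" using that s by (simp add: matchings_on_def)
    then have "f p \<in> \<Union>M" using fe by blast
    then show ?thesis using M unfolding matchings_on_def by blast
  qed
  have "strict_mono_on {0..<2*k} (h \<circ> f)"
    using strict_mono_onD[OF f] strict_mono_onD[OF h] fA by (intro strict_mono_onI) auto
  moreover have "(h \<circ> f) ` e \<in> (`) h ` M" if "e \<in> \<sigma>" for e
    using fe[OF that] by (auto simp: image_comp[symmetric])
  ultimately show ?thesis unfolding embeds_def by blast
qed

text \<open>The increasing enumeration of \<open>A\<close> and its inverse carry avoiders to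
  avoiders, so only the size of the ground set counts.\<close>

lemma card_avoiders_on:
  assumes s: "\<sigma> \<in> matchings_on {0..<2*k}" and "finite A"
  shows "card (avoiders_on k \<sigma> A) = card (avoiders_on k \<sigma> {0..<card A})"
proof -
  obtain h where bij: "bij_betw h {0..<card A} A" and h: "strict_mono_on {0..<card A} h"
    using ex_bij_betw_strict_mono_card[OF \<open>finite A\<close>] by (metis lessThan_atLeast0)
  define g where "g = inv_into {0..<card A} h"
  let ?C = "{0..<card A}"
  have hg: "h (g x) = x" if "x \<in> A" for x
    using bij that by (simp add: g_def bij_betw_inv_into_right)
  have gh: "g (h x) = x" if "x \<in> ?C" for x
    using bij_betw_inv_into_left[OF bij that] by (simp add: g_def)
  have gA: "g ` A = ?C" and hC: "h ` ?C = A"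
    using bij bij_betw_inv_into[OF bij] by (auto simp: g_def bij_betw_def)
  have g: "strict_mono_on A g"
  proof (rule strict_mono_onI)
    fix r t assume rt: "r \<in> A" "t \<in> A" "r < t"
    then have "h (g r) < h (g t)" using hg by simp
    then show "g r < g t"
      using strict_mono_on_less[OF h, of "g r" "g t"] rt gA by blast
  qed
  have hgM: "(`) h ` (`) g ` M = M" if "M \<in> matchings_on A" for M
  proof -
    have "h ` g ` e = e" if "e \<in> M" for e
    proof -
      have "e \<subseteq> A" using that \<open>M \<in> matchings_on A\<close> unfolding matchings_on_def by blast
      then have "\<And>x. x \<in> e \<Longrightarrow> h (g x) = x" using hg by blast
      then show ?thesis by (force simp: image_image)
    qed
    then show ?thesis by (simp add: image_image)
  qed
  have ghM: "(`) g ` (`) h ` M = M" if "M \<in> matchings_on ?C" for M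
  proof -
    have "g ` h ` e = e" if "e \<in> M" for e
    proof -
      have "e \<subseteq> ?C" using that \<open>M \<in> matchings_on ?C\<close> unfolding matchings_on_def by blast
      then have "\<And>x. x \<in> e \<Longrightarrow> g (h x) = x" using gh by blast
      then show ?thesis by (force simp: image_image)
    qed
    then show ?thesis by (simp add: image_image)
  qed
  have toC: "(`) g ` M \<in> matchings_on ?C" if "M \<in> matchings_on A" for M
    using matchings_on_image[OF that g] gA by simp
  have toA: "(`) h ` M \<in> matchings_on A" if "M \<in> matchings_on ?C" for M
    using matchings_on_image[OF that h] hC by simp
  have "bij_betw ((`) ((`) g)) (avoiders_on k \<sigma> A) (avoiders_on k \<sigma> ?C)"
  proof (rule bij_betw_byWitness[where f' = "(`) ((`) h)"])
    show "(`) ((`) g) ` avoiders_on k \<sigma> A \<subseteq> avoiders_on k \<sigma> ?C"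
      using toC embeds_image[OF s toC h] hgM by (auto simp: avoiders_on_def)
    show "(`) ((`) h) ` avoiders_on k \<sigma> ?C \<subseteq> avoiders_on k \<sigma> A"
      using toA embeds_image[OF s toA g] ghM by (auto simp: avoiders_on_def)
  qed (use hgM ghM in \<open>auto simp: avoiders_on_def\<close>)
  then show ?thesis by (rule bij_betw_same_card)
qed

lemma matchings_on_odd:
  assumes "odd (card A)"
  shows "matchings_on A = {}"
proof -
  have "even (card A)" if "M \<in> matchings_on A" for M
    using that card_Union_matching[of M] by (auto simp: matchings_on_def)
  with assms show ?thesis by blast
qed

section \<open>Inserting and removing one edge\<close>

lemma matchings_on_insert:
  assumes "M \<in> matchings_on (A - {i, q})" "i \<in> A" "q \<in> A" "i \<noteq> q"
  shows "insert {i, q} M \<in> matchings_on A"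
proof -
  have U: "\<Union>M = A - {i, q}" and m: "matching M" using assms(1) by (auto simp: matchings_on_def)
  have "e \<inter> {i, q} = {}" if "e \<in> M" for e using U that by blast
  moreover have "\<Union>(insert {i, q} M) = A" using U assms by auto
  ultimately show ?thesis
    using m assms(4) unfolding matchings_on_def matching_def
    by (auto simp: Int_commute)
qed

lemma matchings_on_remove:
  assumes "M \<in> matchings_on A" "{i, q} \<in> M"
  shows "M - {{i, q}} \<in> matchings_on (A - {i, q})"
proof -
  have U: "\<Union>M = A" and m: "matching M" using assms(1) by (auto simp: matchings_on_def)
  have "e \<inter> {i, q} = {}" if "e \<in> M - {{i, q}}" for e
    using matching_edges_eq[OF m _ assms(2)] that by (metis DiffE disjoint_iff singletonI)
  moreover have "A = \<Union>(M - {{i, q}}) \<union> {i, q}"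
    using U assms(2) by (metis Union_insert insert_Diff sup_commute)
  ultimately have "\<Union>(M - {{i, q}}) = A - {i, q}" by blast
  then show ?thesis
    using m by (auto simp: matchings_on_def intro: matching_subset)
qed

text \<open>The partner \<open>i\<close> of the fixed point \<open>q\<close> sorts the matchings
  into disjoint classes, and deleting \<open>{i, q}\<close> is injective on each. The arbitrary
  predicate \<open>P\<close> lets one recursion serve both bipartite matchings and first
  occurrences.\<close>

lemma card_matchings_on_by_edge:
  assumes "finite A" "q \<in> A"
  shows "card {M \<in> matchings_on A. P M} =
    (\<Sum>i\<in>A - {q}. card {M \<in> matchings_on (A - {i, q}). P (insert {i, q} M)})"
proof -
  define N where "N i = {M \<in> matchings_on (A - {i, q}). P (insert {i, q} M)}" for i
  have eq: "{M \<in> matchings_on A. P M} = (\<Union>i\<in>A - {q}. insert {i, q} ` N i)"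
  proof (intro equalityI subsetI)
    fix M assume M: "M \<in> {M \<in> matchings_on A. P M}"
    then have mM: "matching M" "q \<in> \<Union>M" using assms by (auto simp: matchings_on_def)
    then obtain e where e: "e \<in> M" "q \<in> e" by blast
    then obtain i where i: "e = {i, q}" "i \<noteq> q"
      using matching_edgeE[OF mM(1)] by (metis insert_commute)
    have "i \<in> A" using e i M by (auto simp: matchings_on_def)
    moreover have "insert {i, q} (M - {{i, q}}) = M" using e i by blast
    moreover have "M - {{i, q}} \<in> matchings_on (A - {i, q})"
      using matchings_on_remove M e i by blast
    ultimately have "M \<in> insert {i, q} ` N i" "i \<in> A - {q}"
      using M i unfolding N_def by (auto intro!: image_eqI[of _ _ "M - {{i, q}}"])
    then show "M \<in> (\<Union>i\<in>A - {q}. insert {i, q} ` N i)" by blast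
  next
    fix M assume "M \<in> (\<Union>i\<in>A - {q}. insert {i, q} ` N i)"
    then show "M \<in> {M \<in> matchings_on A. P M}"
      using matchings_on_insert assms by (auto simp: N_def)
  qed
  have fin: "finite (insert {i, q} ` N i)" for i using assms by (simp add: N_def)
  have disj: "insert {i, q} ` N i \<inter> insert {j, q} ` N j = {}"
    if ij: "i \<in> A - {q}" "j \<in> A - {q}" "i \<noteq> j" for i j
  proof -
    have False if "M \<in> insert {i, q} ` N i" "M \<in> insert {j, q} ` N j" for M
    proof -
      have "matching M"
        using that(1) matchings_on_insert ij assms by (auto simp: N_def matchings_on_def)
      moreover have "{i, q} \<in> M" "{j, q} \<in> M"
        using that by (metis imageE insertI1)+
      ultimately have "{i, q} = {j, q}" by (rule matching_edges_eq[where x = q]) auto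
      then show False using ij by (auto simp: doubleton_eq_iff)
    qed
    then show ?thesis by blast
  qed
  have inj: "inj_on (insert {i, q}) (N i)" for i
  proof -
    have "{i, q} \<notin> M" if "M \<in> N i" for M using that by (auto simp: N_def matchings_on_def)
    then show ?thesis by (intro inj_onI) (metis insert_ident)
  qed
  have "card {M \<in> matchings_on A. P M} = (\<Sum>i\<in>A - {q}. card (insert {i, q} ` N i))"
    unfolding eq by (rule card_UN_disjoint) (use assms fin disj in auto)
  then show ?thesis by (simp add: card_image[OF inj] N_def[symmetric])
qed

section \<open>Juxtaposition and bipartite matchings\<close>

text \<open>An edge with ends on both sides of \<open>p\<close> is neither here nor in
  \<open>edges_above p\<close>; it cannot belong to a copy of a pattern that lies on one side of
  \<open>p\<close>.\<close>

definition edges_below :: "nat \<Rightarrow> nat set set \<Rightarrow> nat set set" where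
  "edges_below p M = {e \<in> M. e \<subseteq> {..<p}}"

definition edges_above :: "nat \<Rightarrow> nat set set \<Rightarrow> nat set set" where
  "edges_above p M = {e \<in> M. e \<subseteq> {p..}}"

lemma matchings_on_Un:
  assumes "M \<in> matchings_on A" "N \<in> matchings_on B" "A \<inter> B = {}"
  shows "M \<union> N \<in> matchings_on (A \<union> B)"
proof -
  have "e \<inter> e' = {}" if "e \<in> M" "e' \<in> N" for e e'
    using assms that unfolding matchings_on_def by blast
  moreover from this have "e' \<inter> e = {}" if "e \<in> M" "e' \<in> N" for e e'
    using that by blast
  ultimately show ?thesis
    using assms(1,2) unfolding matchings_on_def matching_def by (simp add: ball_Un)
qed

lemma shift_matchings_on:
  assumes "\<tau> \<in> matchings_on {0..<2*m}"
  shows "(\<lambda>e. (\<lambda>i. i + 2*k) ` e) ` \<tau> \<in> matchings_on {2*k..<2*(k + m)}"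
proof -
  have "strict_mono_on {0..<2*m} (\<lambda>i. i + 2*k)" by (auto intro: strict_mono_onI)
  moreover have "(\<lambda>i. i + 2*k) ` {0..<2*m} = {2*k..<2*(k + m)}"
    by (simp add: algebra_simps)
  ultimately show ?thesis
    using matchings_on_image[OF assms, of "\<lambda>i. i + 2*k"] by simp
qed

lemma is_matching_juxt:
  assumes "is_matching k \<sigma>" "is_matching m \<tau>"
  shows "is_matching (k + m) (juxt k \<sigma> \<tau>)"
proof -
  have "{0..<2*k} \<union> {2*k..<2*(k + m)} = {0..<2*(k + m)}" by auto
  moreover have "{0..<2*k} \<inter> {2*k..<2*(k + m)} = {}" by auto
  ultimately show ?thesis
    using matchings_on_Un[OF _ shift_matchings_on, of \<sigma> "{0..<2*k}" \<tau> m k] assms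
    unfolding is_matching_iff juxt_def by simp
qed

text \<open>All vertices of \<open>\<sigma>\<close> precede those of the shifted
  \<open>\<tau>\<close>, so a cut \<open>p\<close> separates their images; conversely, copies on the
  two sides of a cut join into one increasing map.\<close>

lemma embeds_juxt:
  assumes s: "is_matching k \<sigma>" and t: "is_matching m \<tau>" and "k > 0"
  shows "embeds (k + m) (juxt k \<sigma> \<tau>) M \<longleftrightarrow>
    (\<exists>p. embeds k \<sigma> (edges_below p M) \<and> embeds m \<tau> (edges_above p M))"
proof
  assume "embeds (k + m) (juxt k \<sigma> \<tau>) M"
  then obtain f where f: "strict_mono_on {0..<2*(k + m)} f"
    and fe: "\<And>e. e \<in> juxt k \<sigma> \<tau> \<Longrightarrow> f ` e \<in> M"
    unfolding embeds_def by blast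
  \<comment> \<open>The cut is placed just after the image of the last vertex of
    \<open>\<sigma>\<close>; \<open>k > 0\<close> makes \<open>2*k - 1\<close> that vertex.\<close>
  define p where "p = Suc (f (2*k - 1))"
  have less: "f i < f j" if "i < j" "j < 2*(k + m)" for i j
    using strict_mono_onD[OF f] that by simp
  have low: "f i < p" if "i < 2*k" for i
  proof (cases "i = 2*k - 1")
    case False
    then have "f i < f (2*k - 1)" using that \<open>k > 0\<close> by (intro less) auto
    then show ?thesis by (simp add: p_def)
  qed (simp add: p_def)
  have high: "p \<le> f (i + 2*k)" if "i < 2*m" for i
  proof -
    have "2*k - 1 < i + 2*k" using \<open>k > 0\<close> by linarith
    then show ?thesis using less[of "2*k - 1" "i + 2*k"] that by (simp add: p_def)
  qed
  have "f ` e \<in> edges_below p M" if "e \<in> \<sigma>" for e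
  proof -
    have "e \<subseteq> {0..<2*k}" using s that by (auto simp: is_matching_def)
    then show ?thesis using fe[of e] that low by (auto simp: edges_below_def juxt_def)
  qed
  moreover have "strict_mono_on {0..<2*k} f" using less by (intro strict_mono_onI) auto
  ultimately have "embeds k \<sigma> (edges_below p M)" unfolding embeds_def by blast
  moreover have "(\<lambda>i. f (i + 2*k)) ` e \<in> edges_above p M" if "e \<in> \<tau>" for e
  proof -
    have "e \<subseteq> {0..<2*m}" using t that by (auto simp: is_matching_def)
    then have "\<And>i. i \<in> e \<Longrightarrow> p \<le> f (i + 2*k)" using high by auto
    moreover have "(\<lambda>i. f (i + 2*k)) ` e \<in> M"
      using fe[of "(\<lambda>i. i + 2*k) ` e"] that by (simp add: juxt_def image_image)
    ultimately show ?thesis by (auto simp: edges_above_def)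
  qed
  moreover have "strict_mono_on {0..<2*m} (\<lambda>i. f (i + 2*k))"
    using less by (intro strict_mono_onI) auto
  ultimately show "\<exists>p. embeds k \<sigma> (edges_below p M) \<and> embeds m \<tau> (edges_above p M)"
    unfolding embeds_def by blast
next
  assume "\<exists>p. embeds k \<sigma> (edges_below p M) \<and> embeds m \<tau> (edges_above p M)"
  then obtain p f g where f: "strict_mono_on {0..<2*k} f"
    and fe: "\<And>e. e \<in> \<sigma> \<Longrightarrow> f ` e \<in> edges_below p M"
    and g: "strict_mono_on {0..<2*m} g"
    and ge: "\<And>e. e \<in> \<tau> \<Longrightarrow> g ` e \<in> edges_above p M"
    unfolding embeds_def by blast
  have low: "f i < p" if "i < 2*k" for i
  proof -
    have "i \<in> \<Union>\<sigma>" using s that by (simp add: is_matching_def)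
    then obtain e where "e \<in> \<sigma>" "i \<in> e" by blast
    then show ?thesis using fe[of e] by (auto simp: edges_below_def)
  qed
  have high: "p \<le> g i" if "i < 2*m" for i
  proof -
    have "i \<in> \<Union>\<tau>" using t that by (simp add: is_matching_def)
    then obtain e where "e \<in> \<tau>" "i \<in> e" by blast
    then show ?thesis using ge[of e] by (auto simp: edges_above_def)
  qed
  \<comment> \<open>At the seam \<open>f\<close> stays below \<open>p\<close> while \<open>g\<close>
    is at least \<open>p\<close>, so \<open>h\<close> is increasing.\<close>
  define h where "h i = (if i < 2*k then f i else g (i - 2*k))" for i
  have "strict_mono_on {0..<2*(k + m)} h"
  proof (rule strict_mono_onI)
    fix i j assume ij: "i \<in> {0..<2*(k + m)}" "j \<in> {0..<2*(k + m)}" "i < j"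
    consider "j < 2*k" | "i < 2*k" "2*k \<le> j" | "2*k \<le> i" by linarith
    then show "h i < h j"
    proof cases
      case 1
      then show ?thesis using ij strict_mono_onD[OF f] by (auto simp: h_def)
    next
      case 2
      then have "j - 2*k < 2*m" using ij by auto
      then show ?thesis using 2 low[of i] high[of "j - 2*k"] by (simp add: h_def)
    next
      case 3
      then show ?thesis
        using ij strict_mono_onD[OF g, of "i - 2*k" "j - 2*k"] by (auto simp: h_def)
    qed
  qed
  moreover have "h ` e \<in> M" if e: "e \<in> juxt k \<sigma> \<tau>" for e
  proof -
    consider "e \<in> \<sigma>" | e' where "e' \<in> \<tau>" "e = (\<lambda>i. i + 2*k) ` e'"
      using e by (auto simp: juxt_def)
    then show ?thesis
    proof cases
      case 1
      then have "e \<subseteq> {0..<2*k}" using s by (auto simp: is_matching_def)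
      then have "h ` e = f ` e" by (intro image_cong) (auto simp: h_def)
      then show ?thesis using fe[OF 1] by (simp add: edges_below_def)
    next
      case 2
      have "h (i + 2*k) = g i" for i by (simp add: h_def)
      then have "h ` e = g ` e'" unfolding 2(2) image_image by simp
      then show ?thesis using ge[OF 2(1)] by (simp add: edges_above_def)
    qed
  qed
  ultimately show "embeds (k + m) (juxt k \<sigma> \<tau>) M" unfolding embeds_def by blast
qed

section \<open>Matchings with every edge across a bipartition\<close>

definition bipartite_matchings :: "nat set \<Rightarrow> nat set \<Rightarrow> nat set set set" where
  "bipartite_matchings P R = {X \<in> matchings_on (P \<union> R). \<forall>e\<in>X. e \<inter> P \<noteq> {} \<and> e \<inter> R \<noteq> {}}"

text \<open>Induction on \<open>P\<close>: the new point \<open>q\<close> chooses a partner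
  \<open>i\<close> in \<open>R\<close>, and what remains is a bipartite matching of \<open>P\<close>
  and \<open>R - {i}\<close>.\<close>

lemma card_bipartite_matchings:
  assumes "finite P" "finite R" "P \<inter> R = {}"
  shows "card (bipartite_matchings P R) = (if card P = card R then fact (card P) else 0)"
  using assms unfolding bipartite_matchings_def
proof (induction P arbitrary: R rule: finite_induct)
  case empty
  have "{X \<in> matchings_on ({} \<union> R). \<forall>e\<in>X. e \<inter> {} \<noteq> {} \<and> e \<inter> R \<noteq> {}} =
    (if R = {} then {{}} else {})"
    by (auto simp: matchings_on_def matching_def)
  then show ?case using empty by auto
next
  case (insert q P)
  let ?B = "\<lambda>P R. {X \<in> matchings_on (P \<union> R). \<forall>e\<in>X. e \<inter> P \<noteq> {} \<and> e \<inter> R \<noteq> {}}"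
  have q: "q \<notin> P" "q \<notin> R" and PR: "P \<inter> R = {}" using insert by auto
  have A: "insert q P \<union> R - {q} = P \<union> R" using q by auto
  define c where "c i = card {X \<in> matchings_on (insert q P \<union> R - {i, q}).
    \<forall>e\<in>insert {i, q} X. e \<inter> insert q P \<noteq> {} \<and> e \<inter> R \<noteq> {}}" for i
  have "card (?B (insert q P) R) = (\<Sum>i\<in>P \<union> R. c i)"
    using card_matchings_on_by_edge[of "insert q P \<union> R" q] insert
    unfolding A c_def by simp
  \<comment> \<open>A partner of \<open>q\<close> inside \<open>P\<close> would give an edge that
    misses \<open>R\<close>.\<close>
  also have "\<dots> = (\<Sum>i\<in>R. c i)"
  proof (rule sum.mono_neutral_right)
    show "\<forall>i\<in>P \<union> R - R. c i = 0" using q PR by (auto simp: c_def card_eq_0_iff)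
  qed (use insert in auto)
  also have "\<dots> = (\<Sum>i\<in>R. if card P = card R - 1 then fact (card P) else 0)"
  proof (rule sum.cong)
    fix i assume i: "i \<in> R"
    have set_eq: "insert q P \<union> R - {i, q} = P \<union> (R - {i})" using q PR i by auto
    have "e \<inter> insert q P \<noteq> {} \<and> e \<inter> R \<noteq> {} \<longleftrightarrow> e \<inter> P \<noteq> {} \<and> e \<inter> (R - {i}) \<noteq> {}"
      if "X \<in> matchings_on (P \<union> (R - {i}))" "e \<in> X" for X e
    proof -
      have "e \<subseteq> P \<union> (R - {i})" using that unfolding matchings_on_def by blast
      then show ?thesis using q PR i by blast
    qed
    then have "c i = card (?B P (R - {i}))"
      unfolding c_def set_eq using i by (intro arg_cong[where f = card] Collect_cong) auto
    also have "\<dots> = (if card P = card (R - {i}) then fact (card P) else 0)"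
      by (rule insert.IH) (use insert.prems in auto)
    finally show "c i = (if card P = card R - 1 then fact (card P) else 0)"
      using i insert.prems by simp
  qed simp
  \<comment> \<open>For empty \<open>R\<close> the sum is empty and both sides are 0, so the
    truncation in \<open>card R - 1\<close> does no harm.\<close>
  also have "\<dots> = (if card (insert q P) = card R then fact (card (insert q P)) else 0)"
    using insert by (cases "card R") auto
  finally show ?case .
qed

section \<open>Noncrossing and nonnesting matchings\<close>

text \<open>
  Reading positions from left to right, an edge \<open>{a, b}\<close> with \<open>a < b\<close> is opened at \<open>a\<close> and closed
  at \<open>b\<close>; unmatched points count as still open.  The condition says that every closing position is
  joined to the \<open>R\<close>-least open point: with \<open>R = (>)\<close> this is the last one opened (no crossing), with
  \<open>R = (<)\<close> the first one (no nesting).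
\<close>

definition obeys :: "(nat \<Rightarrow> nat \<Rightarrow> bool) \<Rightarrow> nat set set \<Rightarrow> bool" where
  "obeys R M \<longleftrightarrow> (\<forall>a b c. {a, b} \<in> M \<longrightarrow> a < b \<longrightarrow> c < b \<longrightarrow> c \<noteq> a \<longrightarrow>
     (\<forall>d. {c, d} \<in> M \<longrightarrow> b < d) \<longrightarrow> R a c)"

text \<open>The state of the left-to-right construction after \<open>p\<close> positions:
  \<open>j\<close> edges are closed and \<open>p - 2 * j\<close> points are still open.\<close>

definition obedient :: "(nat \<Rightarrow> nat \<Rightarrow> bool) \<Rightarrow> nat \<Rightarrow> nat \<Rightarrow> nat set set set" where
  "obedient R p j = {M. matching M \<and> \<Union>M \<subseteq> {..<p} \<and> card M = j \<and> obeys R M}"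

lemma obeysD:
  "obeys R M \<Longrightarrow> {a, b} \<in> M \<Longrightarrow> a < b \<Longrightarrow> c < b \<Longrightarrow> c \<noteq> a \<Longrightarrow>
    (\<And>d. {c, d} \<in> M \<Longrightarrow> b < d) \<Longrightarrow> R a c"
  unfolding obeys_def by blast

text \<open>The new edge closes after all others. At every earlier closing \<open>a\<close> is open
  with or without it, so the old conditions are unchanged; the only new one concerns the choice of
  \<open>a\<close> among the points open at \<open>p\<close>.\<close>

lemma obeys_insert:
  assumes m: "matching M" and U: "\<Union>M \<subseteq> {..<p}" and a: "a < p" "a \<notin> \<Union>M"
  shows "obeys R (insert {a, p} M) \<longleftrightarrow>
    obeys R M \<and> (\<forall>c\<in>{..<p} - \<Union>M. c \<noteq> a \<longrightarrow> R a c)"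
proof (intro iffI conjI ballI impI)
  assume g: "obeys R (insert {a, p} M)"
  show "obeys R M" unfolding obeys_def
  proof (intro allI impI)
    fix x b c assume h: "{x, b} \<in> M" "x < b" "c < b" "c \<noteq> x" "\<forall>d. {c, d} \<in> M \<longrightarrow> b < d"
    have "b < p" using h(1) U by auto
    show "R x c"
    proof (rule obeysD[OF g _ h(2,3,4)])
      show "{x, b} \<in> insert {a, p} M" using h by simp
      fix d assume "{c, d} \<in> insert {a, p} M"
      then show "b < d" using h \<open>b < p\<close> by (auto simp: doubleton_eq_iff)
    qed
  qed
  fix c assume c: "c \<in> {..<p} - \<Union>M" "c \<noteq> a"
  show "R a c"
    by (rule obeysD[OF g, of a p]) (use c a in \<open>auto simp: doubleton_eq_iff\<close>)
next
  assume g: "obeys R M \<and> (\<forall>c\<in>{..<p} - \<Union>M. c \<noteq> a \<longrightarrow> R a c)"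
  show "obeys R (insert {a, p} M)" unfolding obeys_def
  proof (intro allI impI)
    fix x b c assume h: "{x, b} \<in> insert {a, p} M" "x < b" "c < b" "c \<noteq> x"
      "\<forall>d. {c, d} \<in> insert {a, p} M \<longrightarrow> b < d"
    show "R x c"
    proof (cases "{x, b} \<in> M")
      case True
      show ?thesis by (rule obeysD[of R M x b]) (use g h True in auto)
    next
      case False
      then have xb: "x = a" "b = p" using h a by (auto simp: doubleton_eq_iff)
      \<comment> \<open>A point covered by \<open>M\<close> has its partner below \<open>p\<close>,
        so it is no longer open at \<open>p\<close>.\<close>
      have "c \<notin> \<Union>M"
      proof
        assume "c \<in> \<Union>M"
        then obtain e where e: "e \<in> M" "c \<in> e" by blast
        then obtain d where d: "e = {c, d}" using matching_edgeE[OF m] by metis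
        then have "d < p" using e U by auto
        moreover have "p < d" using h(5) d e xb by auto
        ultimately show False by simp
      qed
      then show ?thesis using g h xb by auto
    qed
  qed
qed

section \<open>The ballot recurrence for partial matchings\<close>

lemma finite_obedient [simp]: "finite (obedient R p j)"
  by (rule finite_subset[of _ "Pow (Pow {..<p})"]) (auto simp: obedient_def)

lemma obedient_0: "obedient R p 0 = {{}}"
proof -
  \<comment> \<open>Boundedness rules out infinite sets, whose \<open>card\<close> is 0 as
    well.\<close>
  have "finite M" if "\<Union>M \<subseteq> {..<p}" for M
    using that finite_subset[of "\<Union>M" "{..<p}"] by (auto intro: finite_UnionD)
  then show ?thesis by (auto simp: obedient_def matching_def obeys_def)
qed

lemma obedient_empty: "p < 2 * j \<Longrightarrow> obedient R p j = {}"
proof -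
  have "2 * j \<le> p" if "M \<in> obedient R p j" for M
  proof -
    have "2 * card M \<le> card {..<p}"
      using that card_mono[of "{..<p}" "\<Union>M"] card_Union_matching[of M]
      by (auto simp: obedient_def)
    then show ?thesis using that by (simp add: obedient_def)
  qed
  then show "p < 2 * j \<Longrightarrow> obedient R p j = {}" by fastforce
qed

text \<open>Position \<open>p\<close> either stays unmatched or closes the open point that
  \<open>R\<close> prescribes, which \<open>first\<close> makes unique. The second case needs an
  open point, that is \<open>2 * j < p\<close>.\<close>

lemma card_obedient_Suc:
  assumes first: "\<And>U. finite U \<Longrightarrow> U \<noteq> {} \<Longrightarrow> \<exists>!a. a \<in> U \<and> (\<forall>c\<in>U. c \<noteq> a \<longrightarrow> R a c)"
  shows "card (obedient R (Suc p) (Suc j)) =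
    card (obedient R p (Suc j)) + (if 2 * j < p then card (obedient R p j) else 0)"
proof -
  define opens where "opens M = {..<p} - \<Union>M" for M
  define top where "top M = (THE a. a \<in> opens M \<and> (\<forall>c\<in>opens M. c \<noteq> a \<longrightarrow> R a c))" for M
  define D where "D = (if 2 * j < p then obedient R p j else {})"
  have top: "top M \<in> opens M" "\<forall>c\<in>opens M. c \<noteq> top M \<longrightarrow> R (top M) c" if "M \<in> D" for M
  proof -
    have "card (\<Union>M) = 2 * j" "2 * j < p" "\<Union>M \<subseteq> {..<p}"
      using that card_Union_matching[of M] by (auto simp: D_def obedient_def split: if_splits)
    then have "opens M \<noteq> {}"
      unfolding opens_def by (metis Diff_eq_empty_iff card_lessThan nat_neq_iff subset_antisym)
    then have "\<exists>!a. a \<in> opens M \<and> (\<forall>c\<in>opens M. c \<noteq> a \<longrightarrow> R a c)"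
      by (intro first) (auto simp: opens_def)
    from theI'[OF this] show "top M \<in> opens M" "\<forall>c\<in>opens M. c \<noteq> top M \<longrightarrow> R (top M) c"
      unfolding top_def by blast+
  qed
  have topI: "top M = a" if "M \<in> D" "a \<in> opens M" "\<forall>c\<in>opens M. c \<noteq> a \<longrightarrow> R a c" for M a
  proof -
    have "\<exists>!a. a \<in> opens M \<and> (\<forall>c\<in>opens M. c \<noteq> a \<longrightarrow> R a c)"
      using that(2) by (intro first) (auto simp: opens_def)
    then show ?thesis using top[OF that(1)] that(2,3) by blast
  qed
  define add where "add M = insert {top M, p} M" for M
  have D: "matching M" "\<Union>M \<subseteq> {..<p}" "card M = j" "obeys R M" "finite M" if "M \<in> D" for M
  proof -
    show *: "matching M" "\<Union>M \<subseteq> {..<p}" "card M = j" "obeys R M"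
      using that by (auto simp: D_def obedient_def split: if_splits)
    then show "finite M" using finite_subset[of "\<Union>M" "{..<p}"] by (auto intro: finite_UnionD)
  qed
  have eq: "obedient R (Suc p) (Suc j) = obedient R p (Suc j) \<union> add ` D"
  proof (intro equalityI subsetI)
    fix M assume M: "M \<in> obedient R (Suc p) (Suc j)"
    then have mM: "matching M" "\<Union>M \<subseteq> {..<Suc p}" "card M = Suc j" "obeys R M"
      by (auto simp: obedient_def)
    have MU: "M \<in> matchings_on (\<Union>M)" using mM by (simp add: matchings_on_def)
    show "M \<in> obedient R p (Suc j) \<union> add ` D"
    proof (cases "p \<in> \<Union>M")
      case False
      then have "\<Union>M \<subseteq> {..<p}" using mM(2) by (metis lessThan_Suc subset_insert)
      then show ?thesis using mM by (simp add: obedient_def)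
    next
      case True
      then obtain e where e: "e \<in> M" "p \<in> e" by blast
      then obtain a where a: "e = {a, p}" "a \<noteq> p"
        using matching_edgeE[OF mM(1)] by (metis insert_commute)
      define N where "N = M - {{a, p}}"
      have N: "N \<in> matchings_on (\<Union>M - {a, p})"
        unfolding N_def using matchings_on_remove[OF MU] e a by blast
      then have UN: "\<Union>N = \<Union>M - {a, p}" and mN: "matching N" by (auto simp: matchings_on_def)
      have MN: "M = insert {a, p} N" using e a by (auto simp: N_def)
      have "a \<in> \<Union>M" using e a by blast
      then have "a < p" using mM(2) a by (metis lessThan_iff less_Suc_eq subsetD)
      have sub: "\<Union>N \<subseteq> {..<p}" using UN mM(2) by (auto simp: less_Suc_eq)
      have aN: "a \<notin> \<Union>N" using UN by blast
      have ob: "obeys R N" "\<forall>c\<in>opens N. c \<noteq> a \<longrightarrow> R a c"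
        using obeys_insert[OF mN sub \<open>a < p\<close> aN, of R] mM(4) MN by (auto simp: opens_def)
      have cN: "card N = j" using mM(3) e a by (simp add: N_def)
      \<comment> \<open>The point \<open>a\<close> lies below \<open>p\<close> and outside
        \<open>N\<close>, so the \<open>2 * j\<close> covered points do not fill
        \<open>{..<p}\<close>.\<close>
      have "\<Union>N \<subseteq> {..<p} - {a}" using sub aN by blast
      then have "card (\<Union>N) \<le> card ({..<p} - {a})" by (intro card_mono) auto
      then have "2 * j < p" using card_Union_matching[OF mN] cN \<open>a < p\<close> by simp
      then have ND: "N \<in> D" using mN sub cN ob by (simp add: D_def obedient_def)
      have "top N = a"
        by (rule topI[OF ND _ ob(2)]) (use \<open>a < p\<close> aN in \<open>simp add: opens_def\<close>)
      then have "M = add N" by (simp add: add_def MN)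
      then show ?thesis using ND by blast
    qed
  next
    fix M assume "M \<in> obedient R p (Suc j) \<union> add ` D"
    then show "M \<in> obedient R (Suc p) (Suc j)"
    proof
      assume "M \<in> obedient R p (Suc j)"
      then show ?thesis by (auto simp: obedient_def less_Suc_eq)
    next
      assume "M \<in> add ` D"
      then obtain N where N: "N \<in> D" "M = insert {top N, p} N" by (auto simp: add_def)
      have t: "top N < p" "top N \<notin> \<Union>N" using top(1)[OF N(1)] by (auto simp: opens_def)
      have "obeys R M"
        using obeys_insert[OF D(1,2)[OF N(1)] t, of R] D(4)[OF N(1)] top(2)[OF N(1)] N(2)
        by (auto simp: opens_def)
      moreover have "{top N, p} \<notin> N" using t by blast
      then have "card M = Suc j" using N D by simp
      moreover have "p \<notin> \<Union>N" using D(2)[OF N(1)] by blast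
      then have "N \<in> matchings_on (insert (top N) (insert p (\<Union>N)) - {top N, p})"
        using t D(1)[OF N(1)] by (auto simp: matchings_on_def)
      then have "M \<in> matchings_on (insert (top N) (insert p (\<Union>N)))"
        unfolding N(2) by (rule matchings_on_insert) (use t in auto)
      ultimately show ?thesis
        using D(2)[OF N(1)] t by (auto simp: obedient_def matchings_on_def less_Suc_eq)
    qed
  qed
  have disj: "obedient R p (Suc j) \<inter> add ` D = {}"
    by (auto simp: obedient_def add_def)
  \<comment> \<open>Deleting the edge at \<open>p\<close> undoes \<open>add\<close>.\<close>
  have inj: "inj_on add D"
  proof (rule inj_on_inverseI[where g = "\<lambda>N. {e \<in> N. p \<notin> e}"])
    fix M assume "M \<in> D"
    then have "p \<notin> \<Union>M" using D(2) by blast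
    then show "{e \<in> add M. p \<notin> e} = M" by (auto simp: add_def)
  qed
  have "finite D" by (simp add: D_def)
  then have "card (obedient R (Suc p) (Suc j)) = card (obedient R p (Suc j)) + card D"
    unfolding eq by (simp add: card_Un_disjoint[OF _ _ disj] card_image[OF inj])
  then show ?thesis by (simp add: D_def)
qed

text \<open>These are ballot numbers with the subtraction moved to the left; the difference of
  neighbouring binomials satisfies the recurrence of \<open>card_obedient_Suc\<close> by Pascal's
  rule.\<close>

lemma card_obedient:
  assumes "\<And>U. finite U \<Longrightarrow> U \<noteq> {} \<Longrightarrow> \<exists>!a. a \<in> U \<and> (\<forall>c\<in>U. c \<noteq> a \<longrightarrow> R a c)"
    and "2 * j < p"
  shows "card (obedient R p (Suc j)) + (p choose j) = (p choose Suc j)"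
  using assms(2)
proof (induction p arbitrary: j)
  case 0
  then show ?case by simp
next
  case (Suc p)
  note rec = card_obedient_Suc[where R = R and p = p and j = j, OF assms(1)]
  show ?case
  proof (cases "2 * j < p")
    case True
    \<comment> \<open>The ballot formula one index lower; for \<open>j = 0\<close> only the empty
      matching is counted.\<close>
    have "card (obedient R p j) + (if j = 0 then 0 else p choose (j - 1)) = (p choose j)"
      using Suc.IH[of "j - 1"] True by (cases j) (auto simp: obedient_0)
    then show ?thesis using Suc.IH[OF True] rec True by (cases j) auto
  next
    case False
    \<comment> \<open>On this boundary both terms of the recurrence vanish, and the two binomials of
      the odd number \<open>Suc p\<close> agree by symmetry.\<close>
    then have p: "p = 2 * j" using Suc.prems by simp
    then have "obedient R p (Suc j) = {}" by (intro obedient_empty) simp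
    moreover have "(Suc p choose j) = (Suc p choose Suc j)"
      using binomial_symmetric[of j "Suc p"] p by simp
    ultimately show ?thesis using rec False by simp
  qed
qed

section \<open>Catalan numbers as differences of binomials\<close>

lemma Suc_times_central_binomial:
  "Suc n * (2 * Suc n choose Suc n) = (n + 2) * (2 * Suc n choose n)"
  using binomial_absorb_comp[of "2 * Suc n" n] binomial_absorption[of n "2 * Suc n"] by simp

text \<open>By \<open>Suc_times_central_binomial\<close>, the central binomial is
  \<open>n + 2\<close> times the difference \<open>t\<close> of the two binomials, so the division
  in \<open>catalan\<close> is exact and yields \<open>t\<close>.\<close>

lemma catalan_Suc_add: "catalan (Suc n) + (2 * Suc n choose n) = (2 * Suc n choose Suc n)"
proof -
  let ?c = "2 * Suc n choose Suc n" and ?d = "2 * Suc n choose n"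
  note * = Suc_times_central_binomial[of n]
  have "Suc n * ?d \<le> Suc n * ?c" unfolding * by (intro mult_le_mono1) simp
  then have "?d \<le> ?c" by (simp only: mult_le_cancel1)
  then obtain t where t: "?c = t + ?d" using le_Suc_ex by (metis add.commute)
  then have "?c = (n + 2) * t" using * by (simp add: algebra_simps)
  moreover have "(n + 2) * t div (n + 2) = t" by (rule nonzero_mult_div_cancel_left) simp
  moreover have "Suc n + 1 = n + 2" by simp
  ultimately have "catalan (Suc n) = t" unfolding catalan_def by metis
  then show ?thesis using t by simp
qed

lemma card_obedient_catalan:
  assumes "\<And>U. finite U \<Longrightarrow> U \<noteq> {} \<Longrightarrow> \<exists>!a. a \<in> U \<and> (\<forall>c\<in>U. c \<noteq> a \<longrightarrow> R a c)"
  shows "card (obedient R (2 * n) n) = catalan n"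
proof (cases n)
  case 0
  then show ?thesis by (simp add: obedient_0 catalan_def)
next
  case (Suc j)
  then show ?thesis
    using card_obedient[where R = R and j = j and p = "2 * n", OF assms] catalan_Suc_add[of j] by simp
qed

lemma first_less: "finite U \<Longrightarrow> U \<noteq> {} \<Longrightarrow> \<exists>!a::nat. a \<in> U \<and> (\<forall>c\<in>U. c \<noteq> a \<longrightarrow> a < c)"
  by (rule ex1I[of _ "Min U"]) (simp add: le_neq_implies_less, metis Min_in Min_le leD)

lemma first_greater: "finite U \<Longrightarrow> U \<noteq> {} \<Longrightarrow> \<exists>!a::nat. a \<in> U \<and> (\<forall>c\<in>U. c \<noteq> a \<longrightarrow> a > c)"
  by (rule ex1I[of _ "Max U"]) (simp add: le_neq_implies_less, metis Max_in Max_ge leD)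

section \<open>The patterns 1212 and 1221 in terms of \<open>obeys\<close>\<close>

lemma strict_mono_on_4:
  assumes "a < b" "b < c" "c < (d::nat)"
  obtains f :: "nat \<Rightarrow> nat"
    where "strict_mono_on {0..<2*2} f" "f 0 = a" "f 1 = b" "f 2 = c" "f 3 = d"
proof
  let ?f = "\<lambda>i::nat. if i = 0 then a else if i = 1 then b else if i = 2 then c else d"
  show "strict_mono_on {0..<2*2} ?f" by (rule strict_mono_onI) (use assms in auto)
qed auto

lemma embeds_1212: "embeds 2 m1212 M \<longleftrightarrow>
  (\<exists>a b c d. a < b \<and> b < c \<and> c < d \<and> {a, c} \<in> M \<and> {b, d} \<in> M)"
proof
  assume "embeds 2 m1212 M"
  then obtain f where f: "strict_mono_on {0..<2*2::nat} f" "\<forall>e\<in>m1212. f ` e \<in> M"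
    unfolding embeds_def by blast
  then have "f 0 < f 1" "f 1 < f 2" "f 2 < f 3" by (auto intro: strict_mono_onD)
  then show "\<exists>a b c d. a < b \<and> b < c \<and> c < d \<and> {a, c} \<in> M \<and> {b, d} \<in> M"
    using f(2) by (auto simp: m1212_def)
next
  assume "\<exists>a b c d. a < b \<and> b < c \<and> c < d \<and> {a, c} \<in> M \<and> {b, d} \<in> M"
  then obtain a b c d where "a < b" "b < c" "c < d" "{a, c} \<in> M" "{b, d} \<in> M" by blast
  moreover from this obtain f where "strict_mono_on {0..<2*2::nat} f"
      "f 0 = a" "f 1 = b" "f 2 = c" "f 3 = d"
    using strict_mono_on_4[of a b c d] by metis
  ultimately show "embeds 2 m1212 M" unfolding embeds_def m1212_def
    by (intro exI[of _ f]) auto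
qed

lemma embeds_1221: "embeds 2 m1221 M \<longleftrightarrow>
  (\<exists>a b c d. a < b \<and> b < c \<and> c < d \<and> {a, d} \<in> M \<and> {b, c} \<in> M)"
proof
  assume "embeds 2 m1221 M"
  then obtain f where f: "strict_mono_on {0..<2*2::nat} f" "\<forall>e\<in>m1221. f ` e \<in> M"
    unfolding embeds_def by blast
  then have "f 0 < f 1" "f 1 < f 2" "f 2 < f 3" by (auto intro: strict_mono_onD)
  then show "\<exists>a b c d. a < b \<and> b < c \<and> c < d \<and> {a, d} \<in> M \<and> {b, c} \<in> M"
    using f(2) by (auto simp: m1221_def)
next
  assume "\<exists>a b c d. a < b \<and> b < c \<and> c < d \<and> {a, d} \<in> M \<and> {b, c} \<in> M"
  then obtain a b c d where "a < b" "b < c" "c < d" "{a, d} \<in> M" "{b, c} \<in> M" by blast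
  moreover from this obtain f where "strict_mono_on {0..<2*2::nat} f"
      "f 0 = a" "f 1 = b" "f 2 = c" "f 3 = d"
    using strict_mono_on_4[of a b c d] by metis
  ultimately show "embeds 2 m1221 M" unfolding embeds_def m1221_def
    by (intro exI[of _ f]) auto
qed

text \<open>With every point matched, \<open>c\<close> is open at \<open>b\<close> iff its partner
  lies beyond \<open>b\<close>, so the condition only compares pairs of edges.\<close>

lemma obeys_perfect:
  assumes M: "M \<in> matchings_on {0..<N}"
  shows "obeys R M \<longleftrightarrow>
    (\<forall>a b c d. {a, b} \<in> M \<longrightarrow> {c, d} \<in> M \<longrightarrow> a < b \<longrightarrow> c < b \<longrightarrow> b < d \<longrightarrow> R a c)"
proof
  assume ob: "obeys R M"
  show "\<forall>a b c d. {a, b} \<in> M \<longrightarrow> {c, d} \<in> M \<longrightarrow> a < b \<longrightarrow> c < b \<longrightarrow> b < d \<longrightarrow> R a c"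
  proof (intro allI impI)
    fix a b c d assume h: "{a, b} \<in> M" "{c, d} \<in> M" "a < b" "c < b" "b < d"
    have m: "matching M" using M by (simp add: matchings_on_def)
    show "R a c"
    proof (rule obeysD[OF ob h(1,3,4)])
      show "c \<noteq> a" using matching_edges_eq[OF m h(1,2), of c] h by (auto simp: doubleton_eq_iff)
      fix x assume "{c, x} \<in> M"
      then have "{c, x} = {c, d}" using matching_edges_eq[OF m _ h(2), of "{c, x}" c] by simp
      then show "b < x" using h by (auto simp: doubleton_eq_iff)
    qed
  qed
next
  assume g: "\<forall>a b c d. {a, b} \<in> M \<longrightarrow> {c, d} \<in> M \<longrightarrow> a < b \<longrightarrow> c < b \<longrightarrow> b < d \<longrightarrow> R a c"
  show "obeys R M" unfolding obeys_def
  proof (intro allI impI)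
    fix a b c assume h: "{a, b} \<in> M" "a < b" "c < b" "c \<noteq> a" "\<forall>d. {c, d} \<in> M \<longrightarrow> b < d"
    have m: "matching M" and U: "\<Union>M = {0..<N}" using M by (auto simp: matchings_on_def)
    have "b \<in> \<Union>M" using h(1) by blast
    then have "c \<in> \<Union>M" using U h by simp
    then obtain e where e: "e \<in> M" "c \<in> e" by blast
    then obtain d where "e = {c, d}" using matching_edgeE[OF m] by metis
    then show "R a c" using g h e by blast
  qed
qed

text \<open>Here \<open>n\<close> disjoint edges within \<open>2 * n\<close> positions cover all of
  them, so the partial matchings are perfect.\<close>

lemma avoiders_on_eq_obedient:
  assumes "\<And>M. M \<in> matchings_on {0..<2*n} \<Longrightarrow> embeds k \<sigma> M \<longleftrightarrow> \<not> obeys R M"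
  shows "avoiders_on k \<sigma> {0..<2*n} = obedient R (2 * n) n"
proof (intro equalityI subsetI)
  fix M assume "M \<in> avoiders_on k \<sigma> {0..<2*n}"
  then show "M \<in> obedient R (2 * n) n"
    using assms card_Union_matching[of M]
    by (auto simp: avoiders_on_def obedient_def matchings_on_def)
next
  fix M assume M: "M \<in> obedient R (2 * n) n"
  then have "\<Union>M = {..<2*n}"
    using card_Union_matching[of M] by (intro card_subset_eq) (auto simp: obedient_def)
  then have "M \<in> matchings_on {0..<2*n}"
    using M by (simp add: obedient_def matchings_on_def lessThan_atLeast0)
  then show "M \<in> avoiders_on k \<sigma> {0..<2*n}"
    using assms M by (simp add: avoiders_on_def obedient_def)
qed

text \<open>If \<open>{a, b}\<close> closes while \<open>{c, d}\<close> is open, the edges cross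
  when \<open>a < c\<close> and nest when \<open>c < a\<close>. Requiring \<open>a > c\<close>
  forbids exactly the crossings.\<close>

lemma card_avoiders_on_1212: "card (avoiders_on 2 m1212 {0..<2*n}) = catalan n"
proof -
  have "embeds 2 m1212 M \<longleftrightarrow> \<not> obeys (>) M" if M: "M \<in> matchings_on {0..<2*n}" for M
  proof -
    have m: "matching M" using M by (simp add: matchings_on_def)
    have neq: "a \<noteq> c" if "{a, b} \<in> M" "{c, d} \<in> M" "b < d" for a b c d
      using matching_edges_eq[OF m that(1,2), of c] that(3) by (auto simp: doubleton_eq_iff)
    show ?thesis
    proof
      assume "embeds 2 m1212 M"
      then obtain a b c d where h: "a < b" "b < c" "c < d" "{a, c} \<in> M" "{b, d} \<in> M"
        unfolding embeds_1212 by blast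
      show "\<not> obeys (>) M"
      proof
        assume "obeys (>) M"
        \<comment> \<open>The edge \<open>{a, c}\<close> closes while \<open>{b, d}\<close> is
          open.\<close>
        then have "b < a"
          using h unfolding obeys_perfect[OF M] by (meson less_trans)
        then show False using h by simp
      qed
    next
      assume "\<not> obeys (>) M"
      then obtain a b c d where h: "{a, b} \<in> M" "{c, d} \<in> M" "a < b" "c < b" "b < d" "\<not> c < a"
        unfolding obeys_perfect[OF M] by blast
      then have "a < c" using neq[OF h(1,2,5)] by simp
      then show "embeds 2 m1212 M" unfolding embeds_1212 using h by blast
    qed
  qed
  then show ?thesis
    using avoiders_on_eq_obedient[of n 2 m1212 "(>)"] card_obedient_catalan[OF first_greater]
    by simp
qed

text \<open>The same comparison of left ends, now with \<open>(<)\<close>, forbids exactly the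
  nestings.\<close>

lemma card_avoiders_on_1221: "card (avoiders_on 2 m1221 {0..<2*n}) = catalan n"
proof -
  have "embeds 2 m1221 M \<longleftrightarrow> \<not> obeys (<) M" if M: "M \<in> matchings_on {0..<2*n}" for M
  proof -
    have m: "matching M" using M by (simp add: matchings_on_def)
    have neq: "a \<noteq> c" if "{a, b} \<in> M" "{c, d} \<in> M" "b < d" for a b c d
      using matching_edges_eq[OF m that(1,2), of c] that(3) by (auto simp: doubleton_eq_iff)
    show ?thesis
    proof
      assume "embeds 2 m1221 M"
      then obtain a b c d where h: "a < b" "b < c" "c < d" "{a, d} \<in> M" "{b, c} \<in> M"
        unfolding embeds_1221 by blast
      show "\<not> obeys (<) M"
      proof
        assume "obeys (<) M"
        \<comment> \<open>The inner edge \<open>{b, c}\<close> closes while \<open>{a, d}\<close> is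
          open.\<close>
        then have "b < a"
          using h unfolding obeys_perfect[OF M] by (meson less_trans)
        then show False using h by simp
      qed
    next
      assume "\<not> obeys (<) M"
      then obtain a b c d where h: "{a, b} \<in> M" "{c, d} \<in> M" "a < b" "c < b" "b < d" "\<not> a < c"
        unfolding obeys_perfect[OF M] by blast
      then have "c < a" using neq[OF h(1,2,5)] by simp
      then show "embeds 2 m1221 M" unfolding embeds_1221 using h by blast
    qed
  qed
  then show ?thesis
    using avoiders_on_eq_obedient[of n 2 m1221 "(<)"] card_obedient_catalan[OF first_less]
    by simp
qed

lemma is_matching_sigma:
  assumes "\<sigma> \<in> {m1212, m1221}"
  shows "is_matching 2 \<sigma>"
proof -
  have four: "{0..<2*2::nat} = {0, 1, 2, 3}" by auto
  have "is_matching 2 m1212" unfolding is_matching_def m1212_def four by auto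
  moreover have "is_matching 2 m1221" unfolding is_matching_def m1221_def four by auto
  ultimately show ?thesis using assms by auto
qed

lemma card_avoiders_on_sigma:
  assumes "\<sigma> \<in> {m1212, m1221}" "finite A" "card A = 2 * n"
  shows "card (avoiders_on 2 \<sigma> A) = catalan n"
  using assms card_avoiders_on[of \<sigma> 2 A] card_avoiders_on_1212 card_avoiders_on_1221
    is_matching_sigma[OF assms(1)] by (auto simp: is_matching_iff)

section \<open>Binomial identities behind the count of prefixes\<close>

lemma binomial_eq_catalan_mult:
  "((2 * n + 1) choose n) = (2 * n + 1) * catalan n"
proof -
  have c: "(n + 1) * catalan n = (2 * n choose n)"
  proof (cases n)
    case (Suc j)
    note Suc_times_central_binomial[of j]
    moreover have "(j + 2) * catalan (Suc j) + (j + 2) * (2 * Suc j choose j) =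
        (j + 2) * (2 * Suc j choose Suc j)"
      using catalan_Suc_add[of j] by (metis distrib_left)
    ultimately show ?thesis unfolding Suc by (simp add: algebra_simps)
  qed (simp add: catalan_def)
  \<comment> \<open>Absorption applies after multiplying by \<open>n + 1\<close>; this factor is
    cancelled at the end.\<close>
  have "(n + 1) * ((2 * n + 1) choose n) = (2 * n + 1) * (2 * n choose n)"
    using binomial_absorb_comp[of "2 * n + 1" n] by simp
  also have "\<dots> = (n + 1) * ((2 * n + 1) * catalan n)" using c by (metis mult.left_commute)
  finally show ?thesis by (metis mult_left_cancel add_is_0 one_neq_zero)
qed

text \<open>Pascal's rule on both binomials of \<open>catalan_Suc_add\<close> leaves a common term
  that cancels; symmetry and \<open>binomial_eq_catalan_mult\<close> do the rest. The right side
  will count matchings that avoid the pattern once the edge at the last point is deleted.\<close>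

lemma catalan_binomial_difference:
  assumes "l \<ge> 2"
  shows "catalan l + ((2*l - 1) choose (l - 2)) = (2*l - 1) * catalan (l - 1)"
proof -
  obtain j where l: "l = j + 2" using assms le_Suc_ex by (metis add.commute)
  have "2 * Suc (Suc j) = Suc (2 * j + 3)" "l = Suc (Suc j)" using l by simp_all
  then have "catalan l + (Suc (2 * j + 3) choose Suc j) = (Suc (2 * j + 3) choose Suc (Suc j))"
    using catalan_Suc_add[of "Suc j"] by metis
  then have "catalan l + (2 * j + 3 choose j) = (2 * j + 3 choose Suc (Suc j))"
    unfolding binomial_Suc_Suc by linarith
  also have "\<dots> = (2 * j + 3 choose Suc j)"
    using binomial_symmetric[of "Suc j" "2 * j + 3"] by (simp add: numeral_eq_Suc)
  also have "\<dots> = (2 * j + 3) * catalan (Suc j)"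
    using binomial_eq_catalan_mult[of "Suc j"] by (simp add: numeral_eq_Suc)
  finally show ?thesis unfolding l by (simp add: numeral_eq_Suc)
qed

section \<open>Cutting after the first occurrence\<close>

lemma sum_Pow_card:
  assumes "finite S"
  shows "(\<Sum>P\<in>Pow S. F (card P)) = (\<Sum>k\<le>card S. (card S choose k) * (F k :: nat))"
proof -
  have "(\<Sum>P\<in>Pow S. F (card P)) = (\<Sum>k\<le>card S. \<Sum>P\<in>{P \<in> Pow S. card P = k}. F (card P))"
    using assms by (intro sum.group[symmetric]) (auto intro: card_mono)
  also have "\<dots> = (\<Sum>k\<le>card S. (card S choose k) * F k)"
    using assms n_subsets[OF assms] by (intro sum.cong) (auto simp: Pow_def)
  finally show ?thesis .
qed

text \<open>Meant for \<open>B \<subseteq> {..q}\<close>: passing to \<open>edges_below q\<close>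
  then drops only the edge at \<open>q\<close>, so \<open>q\<close> is the point that completes the
  first occurrence.\<close>

definition first_occurrence_at :: "nat \<Rightarrow> nat set set \<Rightarrow> nat set \<Rightarrow> nat set set set" where
  "first_occurrence_at q \<sigma> B =
     {M \<in> matchings_on B. embeds 2 \<sigma> M \<and> \<not> embeds 2 \<sigma> (edges_below q M)}"

text \<open>
  For \<open>c = 2\<close> the formula for \<open>c \<ge> 4\<close> would evaluate to 1 because of truncated subtraction; the
  correct value is 0.
\<close>

definition first_occurrence_count :: "nat \<Rightarrow> nat" where
  "first_occurrence_count c = (if even c \<and> 4 \<le> c then (c - 1) choose (c div 2 - 2) else 0)"

lemma edges_below_insert:
  assumes "M \<in> matchings_on (B - {i, q})" "B \<subseteq> {..q}"
  shows "edges_below q (insert {i, q} M) = M"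
proof -
  have "e \<subseteq> {..<q}" if "e \<in> M" for e
  proof -
    have "e \<subseteq> B - {i, q}" using assms(1) that unfolding matchings_on_def by blast
    then show ?thesis using assms(2) le_neq_implies_less by blast
  qed
  moreover have "\<not> {i, q} \<subseteq> {..<q}" by simp
  ultimately show ?thesis unfolding edges_below_def by blast
qed

lemma card_first_occurrence_at:
  assumes \<sigma>: "\<sigma> \<in> {m1212, m1221}" and B: "B \<subseteq> {..q}"
  shows "card (first_occurrence_at q \<sigma> B) = (if q \<in> B then first_occurrence_count (card B) else 0)"
proof (cases "q \<in> B \<and> even (card B)")
  case False
  \<comment> \<open>Without \<open>q\<close> all edges lie below \<open>q\<close>, and the two
    conditions contradict each other.\<close>
  have "first_occurrence_at q \<sigma> B = {}" if "q \<notin> B"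
  proof -
    have "edges_below q M = M" if "M \<in> matchings_on B" for M
    proof -
      have "B \<subseteq> {..<q}" using B \<open>q \<notin> B\<close> by (metis lessThan_Suc lessThan_Suc_atMost subset_insert)
      then show ?thesis using that by (auto simp: edges_below_def matchings_on_def)
    qed
    then show ?thesis by (auto simp: first_occurrence_at_def)
  qed
  moreover have "first_occurrence_at q \<sigma> B = {}" if "odd (card B)"
    using matchings_on_odd[OF that] by (simp add: first_occurrence_at_def)
  ultimately show ?thesis using False by (auto simp: first_occurrence_count_def)
next
  case True
  then obtain l where q: "q \<in> B" and l: "card B = 2 * l" by (auto elim: evenE)
  have fin: "finite B" using B finite_subset by blast
  have "l > 0" using q l fin by (metis card_gt_0_iff empty_iff nat_0_less_mult_iff)
  \<comment> \<open>The edge at \<open>q\<close> may or may not create the pattern here: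
    \<open>q\<close> has \<open>2 * l - 1\<close> possible partners, and the other points carry an
    avoider. Removing the avoiders on \<open>B\<close> leaves the first occurrences.\<close>
  define E where "E = {M \<in> matchings_on B. \<not> embeds 2 \<sigma> (edges_below q M)}"
  have "card E = (\<Sum>i\<in>B - {q}. card (avoiders_on 2 \<sigma> (B - {i, q})))"
    unfolding E_def card_matchings_on_by_edge[OF fin q] avoiders_on_def
    using edges_below_insert[OF _ B] by (intro sum.cong refl arg_cong[where f = card]) auto
  also have "\<dots> = (\<Sum>i\<in>B - {q}. catalan (l - 1))"
  proof (rule sum.cong)
    fix i assume i: "i \<in> B - {q}"
    have "card (B - {i, q}) = card B - card {i, q}"
      using i q fin by (intro card_Diff_subset) auto
    also have "\<dots> = 2 * (l - 1)" using i l by simp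
    finally show "card (avoiders_on 2 \<sigma> (B - {i, q})) = catalan (l - 1)"
      using card_avoiders_on_sigma[OF \<sigma>] fin by simp
  qed simp
  also have "\<dots> = (2 * l - 1) * catalan (l - 1)" using q l fin by simp
  finally have cE: "card E = (2 * l - 1) * catalan (l - 1)" .
  have sub: "avoiders_on 2 \<sigma> B \<subseteq> E"
    using embeds_mono[of 2 \<sigma>] by (auto simp: E_def avoiders_on_def edges_below_def)
  have "first_occurrence_at q \<sigma> B = E - avoiders_on 2 \<sigma> B"
    by (auto simp: first_occurrence_at_def E_def avoiders_on_def)
  then have "card (first_occurrence_at q \<sigma> B) = (2 * l - 1) * catalan (l - 1) - catalan l"
    using card_Diff_subset[OF _ sub] fin cE card_avoiders_on_sigma[OF \<sigma> fin l] by simp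
  also have "\<dots> = first_occurrence_count (card B)"
  proof (cases "l \<ge> 2")
    case True
    then show ?thesis using catalan_binomial_difference[OF True] l
      by (simp add: first_occurrence_count_def)
  next
    case False
    \<comment> \<open>A single edge gives \<open>1 * catalan 0 - catalan 1 = 0\<close>, in agreement
      with the default branch of \<open>first_occurrence_count\<close>.\<close>
    then have "l = 1" using \<open>l > 0\<close> by simp
    moreover have "catalan 1 = 1" "catalan 0 = 1"
      by (simp_all add: catalan_def numeral_2_eq_2[symmetric])
    ultimately show ?thesis using l by (simp add: first_occurrence_count_def)
  qed
  finally show ?thesis using q by simp
qed

section \<open>Splitting and gluing at a cut\<close>

lemma edges_below_mono: "p \<le> p' \<Longrightarrow> edges_below p M \<subseteq> edges_below p' M"
  by (auto simp: edges_below_def)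

lemma edges_above_mono: "p \<le> p' \<Longrightarrow> edges_above p' M \<subseteq> edges_above p M"
  by (auto simp: edges_above_def)

text \<open>Edges of \<open>X\<close> meet both sides of the cut, those of \<open>L\<close> and
  \<open>H\<close> only one, so the three parts can be read off from their union.\<close>

lemma glue_matchings:
  assumes P: "P \<subseteq> {..q}" and R: "R \<subseteq> {Suc q..<N}" and "q < N"
    and L: "L \<in> matchings_on ({..q} - P)"
    and X: "X \<in> bipartite_matchings P R"
    and H: "H \<in> matchings_on ({Suc q..<N} - R)"
  shows "L \<union> X \<union> H \<in> matchings_on {0..<N}"
    and "edges_below (Suc q) (L \<union> X \<union> H) = L"
    and "edges_above (Suc q) (L \<union> X \<union> H) = H"
    and "L \<union> X \<union> H - L - H = X"
proof -
  have X': "X \<in> matchings_on (P \<union> R)" "\<And>e. e \<in> X \<Longrightarrow> e \<inter> P \<noteq> {} \<and> e \<inter> R \<noteq> {}"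
    using X by (auto simp: bipartite_matchings_def)
  have sets: "{..q} - P \<union> (P \<union> R) \<union> ({Suc q..<N} - R) = {0..<N}"
    using P R \<open>q < N\<close> by auto
  have LX: "L \<union> X \<in> matchings_on ({..q} - P \<union> (P \<union> R))"
    by (rule matchings_on_Un[OF L X'(1)]) (use P R in auto)
  show "L \<union> X \<union> H \<in> matchings_on {0..<N}"
    unfolding sets[symmetric] by (rule matchings_on_Un[OF LX H]) (use P R in auto)
  have Le: "e \<subseteq> {..q}" "e \<noteq> {}" if "e \<in> L" for e
    using L that by (auto simp: matchings_on_def matching_def)
  have He: "e \<subseteq> {Suc q..}" "e \<noteq> {}" if "e \<in> H" for e
    using H that by (auto simp: matchings_on_def matching_def)
  have Xe: "\<not> e \<subseteq> {..q}" "\<not> e \<subseteq> {Suc q..}" if e: "e \<in> X" for e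
  proof -
    obtain x y where "x \<in> e" "x \<in> P" "y \<in> e" "y \<in> R" using X'(2)[OF e] by blast
    moreover from this have "x \<le> q" "Suc q \<le> y" using P R by auto
    ultimately show "\<not> e \<subseteq> {..q}" "\<not> e \<subseteq> {Suc q..}" by fastforce+
  qed
  \<comment> \<open>Nonemptiness matters: the empty set lies on both sides of the cut.\<close>
  have LH: "\<not> (e \<subseteq> {..q} \<and> e \<subseteq> {Suc q..})" if "e \<noteq> {}" for e using that by fastforce
  have below: "e \<subseteq> {..q} \<longleftrightarrow> e \<in> L" and above: "e \<subseteq> {Suc q..} \<longleftrightarrow> e \<in> H"
    if e: "e \<in> L \<union> X \<union> H" for e
    using e Le[of e] He[of e] Xe[of e] LH[of e] by (metis Un_iff)+
  show "edges_below (Suc q) (L \<union> X \<union> H) = L"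
    unfolding edges_below_def lessThan_Suc_atMost
    using below by (metis (lifting) Collect_cong Collect_mem_eq UnI1)
  show "edges_above (Suc q) (L \<union> X \<union> H) = H"
    unfolding edges_above_def using above by (metis (lifting) Collect_cong Collect_mem_eq UnI2)
  have "e \<notin> L \<and> e \<notin> H" if "e \<in> X" for e using that Le(1) He(1) Xe by metis
  then show "L \<union> X \<union> H - L - H = X" by blast
qed

text \<open>The converse of gluing. The double complements are the ground sets of
  \<open>glue_matchings\<close> for \<open>P = {..q} - \<Union>L\<close> and
  \<open>R = {Suc q..<N} - \<Union>H\<close>.\<close>

lemma split_matching:
  fixes M N q
  defines "L \<equiv> edges_below (Suc q) M" and "H \<equiv> edges_above (Suc q) M"
  assumes M: "M \<in> matchings_on {0..<N}" and "q < N"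
  shows "L \<in> matchings_on ({..q} - ({..q} - \<Union>L))"
    and "M - L - H \<in> bipartite_matchings ({..q} - \<Union>L) ({Suc q..<N} - \<Union>H)"
    and "H \<in> matchings_on ({Suc q..<N} - ({Suc q..<N} - \<Union>H))"
proof -
  have m: "matching M" and U: "\<Union>M = {0..<N}" using M by (auto simp: matchings_on_def)
  have LM: "L \<subseteq> M" and HM: "H \<subseteq> M" by (auto simp: L_def H_def edges_below_def edges_above_def)
  have UL: "\<Union>L \<subseteq> {..q}" by (auto simp: L_def edges_below_def)
  have UH: "\<Union>H \<subseteq> {Suc q..<N}" using U by (fastforce simp: H_def edges_above_def)
  have "{..q} - ({..q} - \<Union>L) = \<Union>L" using UL by blast
  then show "L \<in> matchings_on ({..q} - ({..q} - \<Union>L))"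
    using matching_subset[OF m LM] by (simp add: matchings_on_def)
  have "{Suc q..<N} - ({Suc q..<N} - \<Union>H) = \<Union>H" using UH by blast
  then show "H \<in> matchings_on ({Suc q..<N} - ({Suc q..<N} - \<Union>H))"
    using matching_subset[OF m HM] by (simp add: matchings_on_def)
  let ?X = "M - L - H"
  have disj: "x \<notin> \<Union>L" "x \<notin> \<Union>H" if "x \<in> e" "e \<in> ?X" for x e
    using matching_edges_eq[OF m, of e _ x] that LM HM by blast+
  have "\<Union>?X = \<Union>M - \<Union>L - \<Union>H"
  proof (intro equalityI subsetI)
    fix x assume "x \<in> \<Union>?X"
    then obtain e where "x \<in> e" "e \<in> ?X" by blast
    then show "x \<in> \<Union>M - \<Union>L - \<Union>H" using disj by blast
  qed blast
  also have "\<Union>M = {..q} \<union> {Suc q..<N}" using U \<open>q < N\<close> by auto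
  also have "\<dots> - \<Union>L - \<Union>H = {..q} - \<Union>L \<union> ({Suc q..<N} - \<Union>H)"
  proof -
    have "{..q} \<inter> {Suc q..<N} = {}" by auto
    then show ?thesis using UL UH by blast
  qed
  finally have UX: "\<Union>?X = {..q} - \<Union>L \<union> ({Suc q..<N} - \<Union>H)" .
  have "e \<inter> ({..q} - \<Union>L) \<noteq> {} \<and> e \<inter> ({Suc q..<N} - \<Union>H) \<noteq> {}" if "e \<in> ?X" for e
  proof -
    have "\<not> e \<subseteq> {..q}" "\<not> e \<subseteq> {Suc q..}"
      using that by (auto simp: L_def H_def edges_below_def edges_above_def lessThan_Suc_atMost)
    \<comment> \<open>The end \<open>x\<close> lies to the right of the cut and \<open>y\<close> to
      the left.\<close>
    then obtain x y where xy: "x \<in> e" "y \<in> e" "\<not> x \<le> q" "\<not> Suc q \<le> y" by blast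
    have "x \<in> \<Union>M" using xy(1) that by blast
    then have "x < N" using U by simp
    moreover have "y \<notin> \<Union>L" "x \<notin> \<Union>H"
      using disj(1)[OF xy(2) that] disj(2)[OF xy(1) that] .
    ultimately have "y \<in> e \<inter> ({..q} - \<Union>L)" "x \<in> e \<inter> ({Suc q..<N} - \<Union>H)"
      using xy by auto
    then show ?thesis by blast
  qed
  then show "?X \<in> bipartite_matchings ({..q} - \<Union>L) ({Suc q..<N} - \<Union>H)"
    using UX matching_subset[OF m, of ?X] by (auto simp: bipartite_matchings_def matchings_on_def)
qed

context
  fixes \<sigma> \<tau> :: "nat set set" and m N :: nat
  assumes \<sigma>: "\<sigma> \<in> {m1212, m1221}" and \<tau>: "is_matching m \<tau>"
begin

text \<open>
  \<open>Suc q\<close> is the length of the shortest prefix containing \<open>\<sigma>\<close>; \<open>P\<close> and \<open>R\<close> are the left and right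
  ends of the edges that leave this prefix.
\<close>

definition first_cut_at :: "nat \<Rightarrow> nat set \<Rightarrow> nat set \<Rightarrow> nat set set set" where
  "first_cut_at q P R = {M \<in> matchings_on {0..<N}.
     embeds 2 \<sigma> (edges_below (Suc q) M) \<and> \<not> embeds 2 \<sigma> (edges_below q M) \<and>
     \<not> embeds m \<tau> (edges_above (Suc q) M) \<and>
     {..q} - \<Union>(edges_below (Suc q) M) = P \<and> {Suc q..<N} - \<Union>(edges_above (Suc q) M) = R}"

text \<open>The conditions on \<open>\<sigma>\<close> and \<open>\<tau>\<close> concern only the
  left and the right part, so splitting and gluing identify the set with a product.\<close>

lemma card_first_cut_at:
  assumes P: "P \<subseteq> {..q}" and R: "R \<subseteq> {Suc q..<N}" and "q < N"
  shows "card (first_cut_at q P R) = card (first_occurrence_at q \<sigma> ({..q} - P)) *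
    (card (bipartite_matchings P R) * card (avoiders_on m \<tau> ({Suc q..<N} - R)))"
proof -
  let ?T = "first_occurrence_at q \<sigma> ({..q} - P) \<times>
    (bipartite_matchings P R \<times> avoiders_on m \<tau> ({Suc q..<N} - R))"
  let ?b = "edges_below (Suc q)" and ?a = "edges_above (Suc q)"
  \<comment> \<open>Edges below \<open>q\<close> already belong to the left part, so the condition
    at \<open>q\<close> depends on that part alone.\<close>
  have bb: "edges_below q M = edges_below q (?b M)" for M by (auto simp: edges_below_def)
  have "bij_betw (\<lambda>(L, X, H). L \<union> X \<union> H) ?T (first_cut_at q P R)"
  proof (rule bij_betw_byWitness[where f' = "\<lambda>M. (?b M, M - ?b M - ?a M, ?a M)"])
    show "\<forall>t\<in>?T. (\<lambda>M. (?b M, M - ?b M - ?a M, ?a M)) (case t of (L, X, H) \<Rightarrow> L \<union> X \<union> H) = t"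
      using glue_matchings(2-4)[OF assms]
      by (auto simp: first_occurrence_at_def avoiders_on_def)
    show "\<forall>M\<in>first_cut_at q P R. (case (?b M, M - ?b M - ?a M, ?a M) of (L, X, H) \<Rightarrow> L \<union> X \<union> H) = M"
      by (auto simp: edges_below_def edges_above_def)
    show "(\<lambda>(L, X, H). L \<union> X \<union> H) ` ?T \<subseteq> first_cut_at q P R"
    proof clarify
      fix L X H assume L: "L \<in> first_occurrence_at q \<sigma> ({..q} - P)"
        and X: "X \<in> bipartite_matchings P R" and H: "H \<in> avoiders_on m \<tau> ({Suc q..<N} - R)"
      have L': "L \<in> matchings_on ({..q} - P)" and H': "H \<in> matchings_on ({Suc q..<N} - R)"
        using L H by (auto simp: first_occurrence_at_def avoiders_on_def)
      have UL: "{..q} - \<Union>L = P" and UH: "{Suc q..<N} - \<Union>H = R"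
        using L' H' P R by (auto simp: matchings_on_def)
      show "L \<union> X \<union> H \<in> first_cut_at q P R"
        unfolding first_cut_at_def mem_Collect_eq bb[of "L \<union> X \<union> H"]
        using glue_matchings[OF assms L' X H'] UL UH L H
        by (simp add: first_occurrence_at_def avoiders_on_def)
    qed
    show "(\<lambda>M. (?b M, M - ?b M - ?a M, ?a M)) ` first_cut_at q P R \<subseteq> ?T"
    proof (rule image_subsetI)
      fix M assume M: "M \<in> first_cut_at q P R"
      then have M': "M \<in> matchings_on {0..<N}" and
        PR: "{..q} - \<Union>(?b M) = P" "{Suc q..<N} - \<Union>(?a M) = R"
        by (auto simp: first_cut_at_def)
      show "(?b M, M - ?b M - ?a M, ?a M) \<in> ?T"
        using split_matching[OF M' \<open>q < N\<close>] M bb[of M] unfolding PR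
        by (simp add: first_cut_at_def first_occurrence_at_def avoiders_on_def)
    qed
  qed
  then have "card (first_cut_at q P R) = card ?T" by (simp add: bij_betw_same_card)
  then show ?thesis by (simp only: card_cartesian_product)
qed

text \<open>Moving the cut to the right only removes edges from the part tested for
  \<open>\<tau>\<close>, so testing after the shortest prefix with \<open>\<sigma>\<close> suffices.
  If no prefix contains \<open>\<sigma>\<close>, the juxtaposition is avoided as well.\<close>

lemma avoiders_on_juxt_decomposition:
  "avoiders_on (2 + m) (juxt 2 \<sigma> \<tau>) {0..<N} = avoiders_on 2 \<sigma> {0..<N} \<union>
    (\<Union>(q, P, R)\<in>(SIGMA q:{..<N}. Pow {..q} \<times> Pow {Suc q..<N}). first_cut_at q P R)"
    (is "?A = ?S \<union> ?D")
proof -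
  have iff: "M \<in> ?A \<longleftrightarrow> M \<in> ?S \<union> ?D" if M: "M \<in> matchings_on {0..<N}" for M
  proof -
    have emb: "embeds (2 + m) (juxt 2 \<sigma> \<tau>) M \<longleftrightarrow>
        (\<exists>p. embeds 2 \<sigma> (edges_below p M) \<and> embeds m \<tau> (edges_above p M))"
      using embeds_juxt[OF is_matching_sigma[OF \<sigma>] \<tau>] by simp
    have inD: "M \<in> ?D \<longleftrightarrow> (\<exists>q<N. embeds 2 \<sigma> (edges_below (Suc q) M) \<and>
        \<not> embeds 2 \<sigma> (edges_below q M) \<and> \<not> embeds m \<tau> (edges_above (Suc q) M))"
      using M by (auto simp: first_cut_at_def)
    show ?thesis
    proof (cases "embeds 2 \<sigma> M")
      case False
      then have "\<not> embeds 2 \<sigma> (edges_below p M)" for p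
        using embeds_mono[of 2 \<sigma> "edges_below p M" M] by (auto simp: edges_below_def)
      then show ?thesis using M False emb by (auto simp: avoiders_on_def)
    next
      case True
      have "edges_below N M = M" using M by (auto simp: edges_below_def matchings_on_def)
      then have N: "embeds 2 \<sigma> (edges_below N M)" using True by simp
      have "edges_below 0 M = {}" using M by (auto simp: edges_below_def matchings_on_def matching_def)
      then have "\<not> embeds 2 \<sigma> (edges_below 0 M)"
        using \<sigma> by (auto simp: embeds_def m1212_def m1221_def)
      \<comment> \<open>There are no edges below \<open>0\<close>, while all edges lie below
        \<open>N\<close>, so \<open>\<sigma>\<close> appears at some step in between.\<close>
      then obtain q where q: "q < N" "\<not> embeds 2 \<sigma> (edges_below q M)"
          "embeds 2 \<sigma> (edges_below (Suc q) M)"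
        using ex_least_nat_less[of "\<lambda>p. embeds 2 \<sigma> (edges_below p M)" N] N by auto
      \<comment> \<open>Monotonicity in \<open>p\<close> turns this step into a threshold, which
        makes \<open>q\<close> unique.\<close>
      have cut: "embeds 2 \<sigma> (edges_below p M) \<longleftrightarrow> Suc q \<le> p" for p
        using q(2,3) embeds_mono[OF _ edges_below_mono] by (metis not_less_eq_eq)
      then have uniq: "q' = q" if "embeds 2 \<sigma> (edges_below (Suc q') M)"
          "\<not> embeds 2 \<sigma> (edges_below q' M)" for q'
        using that by simp
      have "embeds (2 + m) (juxt 2 \<sigma> \<tau>) M \<longleftrightarrow> embeds m \<tau> (edges_above (Suc q) M)"
        unfolding emb cut using embeds_mono[OF _ edges_above_mono] by blast
      moreover have "M \<in> ?D \<longleftrightarrow> \<not> embeds m \<tau> (edges_above (Suc q) M)"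
        unfolding inD using q uniq by blast
      ultimately show ?thesis using M True by (simp add: avoiders_on_def)
    qed
  qed
  have "M \<in> matchings_on {0..<N}" if "M \<in> ?A \<or> M \<in> ?S \<union> ?D" for M
    using that by (auto simp: avoiders_on_def first_cut_at_def)
  then show ?thesis using iff by blast
qed

text \<open>The matching determines its index \<open>(q, P, R)\<close>, so the union in the
  decomposition is disjoint.\<close>

lemma card_avoiders_on_juxt_cuts:
  "card (avoiders_on (2 + m) (juxt 2 \<sigma> \<tau>) {0..<N}) = card (avoiders_on 2 \<sigma> {0..<N}) +
    (\<Sum>q<N. \<Sum>P\<in>Pow {..q}. \<Sum>R\<in>Pow {Suc q..<N}. card (first_cut_at q P R))"
proof -
  let ?I = "SIGMA q:{..<N}. Pow {..q} \<times> Pow {Suc q..<N}"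
  have fin: "finite (first_cut_at q P R)" for q P R by (simp add: first_cut_at_def)
  have "first_cut_at q P R \<inter> first_cut_at q' P' R' = {}" 
    if ne: "(q, P, R) \<noteq> (q', P', R')" for q P R q' P' R'
  proof -
    have "(q, P, R) = (q', P', R')"
      if M: "M \<in> first_cut_at q P R" "M \<in> first_cut_at q' P' R'" for M
    proof -
      \<comment> \<open>If \<open>Suc q \<le> q'\<close>, the copy of \<open>\<sigma>\<close> below
        \<open>Suc q\<close> would lie below \<open>q'\<close> too, against the minimality at
        \<open>q'\<close>.\<close>
      have "\<not> Suc q \<le> q'" "\<not> Suc q' \<le> q"
        using M embeds_mono[OF _ edges_below_mono] unfolding first_cut_at_def by blast+
      then have "q = q'" by simp
      then show ?thesis using M by (auto simp: first_cut_at_def)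
    qed
    then show ?thesis using ne by blast
  qed
  then have "card (\<Union>(q, P, R)\<in>?I. first_cut_at q P R) = (\<Sum>(q, P, R)\<in>?I. card (first_cut_at q P R))"
    using fin by (subst card_UN_disjoint) (auto simp: case_prod_beta intro!: sum.cong)
  also have "\<dots> = (\<Sum>q<N. \<Sum>P\<in>Pow {..q}. \<Sum>R\<in>Pow {Suc q..<N}. card (first_cut_at q P R))"
    by (simp add: sum.cartesian_product sum.Sigma)
  finally have card_D: "card (\<Union>(q, P, R)\<in>?I. first_cut_at q P R) = \<dots>" .
  have "avoiders_on 2 \<sigma> {0..<N} \<inter> (\<Union>(q, P, R)\<in>?I. first_cut_at q P R) = {}"
  proof -
    have "edges_below p M \<subseteq> M" for p M by (auto simp: edges_below_def)
    then show ?thesis using embeds_mono by (fastforce simp: avoiders_on_def first_cut_at_def)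
  qed
  moreover have "finite (\<Union>(q, P, R)\<in>?I. first_cut_at q P R)" using fin by auto
  ultimately show ?thesis
    unfolding avoiders_on_juxt_decomposition card_D[symmetric]
    by (intro card_Un_disjoint) auto
qed

text \<open>For \<open>q \<notin> P\<close> every factor depends only on the sizes of
  \<open>P\<close> and \<open>R\<close>, which must agree. As \<open>q\<close> completes the
  occurrence it cannot belong to \<open>P\<close>, which leaves the \<open>q\<close> points of
  \<open>{..<q}\<close> to choose from.\<close>

lemma sum_card_first_cut_at:
  assumes "q < N"
  shows "(\<Sum>P\<in>Pow {..q}. \<Sum>R\<in>Pow {Suc q..<N}. card (first_cut_at q P R)) =
    (\<Sum>k\<le>q. (q choose k) * (first_occurrence_count (Suc q - k) * (((N - Suc q) choose k) *
      (fact k * card (avoiders_on m \<tau> {0..<N - Suc q - k})))))"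
proof -
  define a where "a c = card (avoiders_on m \<tau> {0..<c})" for c
  let ?T = "{Suc q..<N}"
  let ?g = "\<lambda>k r. (if r = k then fact k * a (N - Suc q - k) else 0) :: nat"
  have cut: "card (first_cut_at q P R) =
      (if q \<in> P then 0 else first_occurrence_count (Suc q - card P) * ?g (card P) (card R))"
    if PR: "P \<in> Pow {..q}" "R \<in> Pow ?T" for P R
  proof -
    have fin: "finite P" "finite R" using PR finite_subset by blast+
    have "P \<inter> R = {}" using PR by fastforce
    then have bip: "card (bipartite_matchings P R) = (if card P = card R then fact (card P) else 0)"
      using fin by (intro card_bipartite_matchings)
    have "card ({..q} - P) = Suc q - card P" using PR fin by (simp add: card_Diff_subset)
    then have fo: "card (first_occurrence_at q \<sigma> ({..q} - P)) =
        (if q \<in> P then 0 else first_occurrence_count (Suc q - card P))"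
      using card_first_occurrence_at[OF \<sigma>, of "{..q} - P" q] by auto
    have "card (?T - R) = N - Suc q - card R" using PR fin by (simp add: card_Diff_subset)
    then have av: "card (avoiders_on m \<tau> (?T - R)) = a (N - Suc q - card R)"
      using card_avoiders_on[of \<tau> m "?T - R"] \<tau> by (simp add: is_matching_iff a_def)
    show ?thesis using PR fo bip av assms by (simp add: card_first_cut_at)
  qed
  have inner: "(\<Sum>R\<in>Pow ?T. ?g k (card R)) = ((N - Suc q) choose k) * (fact k * a (N - Suc q - k))"
    for k
  proof -
    have "(\<Sum>R\<in>Pow ?T. ?g k (card R)) = (\<Sum>r\<le>card ?T. (card ?T choose r) * ?g k r)"
      by (rule sum_Pow_card) simp
    also have "\<dots> = (\<Sum>r\<le>N - Suc q. if r = k then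
        ((N - Suc q) choose k) * (fact k * a (N - Suc q - k)) else 0)"
      by (intro sum.cong) auto
    \<comment> \<open>If \<open>k\<close> exceeds the number of points to the right, no summand is
      selected, and the binomial is 0 as well.\<close>
    also have "\<dots> = ((N - Suc q) choose k) * (fact k * a (N - Suc q - k))"
      by (auto simp: binomial_eq_0)
    finally show ?thesis .
  qed
  have "(\<Sum>P\<in>Pow {..q}. \<Sum>R\<in>Pow ?T. card (first_cut_at q P R)) =
      (\<Sum>P\<in>Pow {..q}. \<Sum>R\<in>Pow ?T. if q \<in> P then 0 else
        first_occurrence_count (Suc q - card P) * ?g (card P) (card R))"
    by (intro sum.cong refl cut)
  also have "\<dots> = (\<Sum>P\<in>Pow {..<q}. \<Sum>R\<in>Pow ?T. if q \<in> P then 0 else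
        first_occurrence_count (Suc q - card P) * ?g (card P) (card R))"
  proof (rule sum.mono_neutral_right)
    show "\<forall>P\<in>Pow {..q} - Pow {..<q}. (\<Sum>R\<in>Pow ?T. if q \<in> P then 0 else
        first_occurrence_count (Suc q - card P) * ?g (card P) (card R)) = 0"
    proof
      fix P assume "P \<in> Pow {..q} - Pow {..<q}"
      then have "q \<in> P" by (metis DiffE PowD PowI lessThan_Suc lessThan_Suc_atMost subset_insert)
      then show "(\<Sum>R\<in>Pow ?T. if q \<in> P then 0 else
        first_occurrence_count (Suc q - card P) * ?g (card P) (card R)) = 0" by simp
    qed
  qed auto
  also have "\<dots> = (\<Sum>P\<in>Pow {..<q}. first_occurrence_count (Suc q - card P) *
      (\<Sum>R\<in>Pow ?T. ?g (card P) (card R)))"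
  proof (rule sum.cong)
    fix P assume "P \<in> Pow {..<q}"
    then have "q \<notin> P" by blast
    then show "(\<Sum>R\<in>Pow ?T. if q \<in> P then 0 else
        first_occurrence_count (Suc q - card P) * ?g (card P) (card R)) =
      first_occurrence_count (Suc q - card P) * (\<Sum>R\<in>Pow ?T. ?g (card P) (card R))"
      by (simp only: if_False sum_distrib_left)
  qed simp
  also have "\<dots> = (\<Sum>k\<le>card {..<q}. (card {..<q} choose k) *
      (first_occurrence_count (Suc q - k) * (\<Sum>R\<in>Pow ?T. ?g k (card R))))"
    by (rule sum_Pow_card) simp
  finally show ?thesis unfolding inner by (simp add: a_def)
qed

end

text \<open>A prefix of length \<open>Suc q\<close> with \<open>l\<close> inner edges and
  \<open>k\<close> points matched across the cut satisfies \<open>Suc q = 2 * l + k\<close>, which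
  explains the substitution \<open>q = 2 * l - 1 + k\<close>.\<close>

lemma sum_cuts_reindex:
  fixes a :: "nat \<Rightarrow> nat"
  shows "(\<Sum>q<2*n. \<Sum>k\<le>q. (q choose k) * (first_occurrence_count (Suc q - k) *
      (((2*n - Suc q) choose k) * (fact k * a (2*n - Suc q - k))))) =
    (\<Sum>l = 2..n. \<Sum>k = 0..n - l.
      ((2*l - 1) choose (l - 2)) * ((2*l - 1 + k) choose k) * ((2*(n - l) - k) choose k)
      * fact k * a (2 * (n - l - k)))"
proof -
  let ?f = "\<lambda>(q, k). (q choose k) * (first_occurrence_count (Suc q - k) *
      (((2*n - Suc q) choose k) * (fact k * a (2*n - Suc q - k))))"
  let ?h = "\<lambda>(l, k). (2*l - 1 + k, k)"
  let ?S = "SIGMA q:{..<2*n}. {..q}" and ?T = "SIGMA l:{2..n}. {0..n - l}"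
  have "(\<Sum>q<2*n. \<Sum>k\<le>q. ?f (q, k)) = sum ?f ?S" by (subst sum.Sigma) auto
  also have "\<dots> = sum ?f (?h ` ?T)"
  proof (rule sum.mono_neutral_right)
    \<comment> \<open>Outside the image the number of inner points is odd or below 4, or fewer than
      \<open>k\<close> points lie to the right of the cut.\<close>
    show "\<forall>x\<in>?S - ?h ` ?T. ?f x = 0"
    proof (rule ballI, rule ccontr)
      fix x assume x: "x \<in> ?S - ?h ` ?T" and "?f x \<noteq> 0"
      then obtain q k where qk: "x = (q, k)" "k \<le> q" "q < 2*n"
        "first_occurrence_count (Suc q - k) \<noteq> 0" "((2*n - Suc q) choose k) \<noteq> 0" by auto
      then have "even (Suc q - k)" "4 \<le> Suc q - k"
        unfolding first_occurrence_count_def by presburger+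
      then obtain l where l: "Suc q - k = 2*l" by (elim evenE)
      then have "2 \<le> l" using \<open>4 \<le> Suc q - k\<close> by simp
      \<comment> \<open>Together with \<open>Suc q = 2 * l + k\<close> this gives
        \<open>l + k \<le> n\<close>.\<close>
      have "k \<le> 2*n - Suc q" using qk(5) by (metis binomial_eq_0 not_le)
      then have "(l, k) \<in> ?T" "x = ?h (l, k)" using l \<open>2 \<le> l\<close> qk(1-3) by auto
      then have "x \<in> ?h ` ?T" by (rule rev_image_eqI)
      with x show False by (rule DiffD2)
    qed
  qed auto
  also have "\<dots> = sum (?f \<circ> ?h) ?T" by (rule sum.reindex) (auto simp: inj_on_def)
  also have "\<dots> = (\<Sum>(l, k)\<in>?T. ((2*l - 1) choose (l - 2)) * ((2*l - 1 + k) choose k) *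
      ((2*(n - l) - k) choose k) * fact k * a (2 * (n - l - k)))"
  proof (rule sum.cong)
    fix x assume "x \<in> ?T"
    then obtain l k where x: "x = (l, k)" "2 \<le> l" "l \<le> n" "k \<le> n - l" by auto
    \<comment> \<open>The bounds \<open>2 \<le> l\<close> and \<open>k \<le> n - l\<close> make all
      these truncated subtractions exact.\<close>
    have eqs: "Suc (2*l - 1 + k) - k = 2*l" "2*n - Suc (2*l - 1 + k) = 2*(n - l) - k"
      "2*(n - l) - k - k = 2*(n - l - k)" using x by auto
    show "(?f \<circ> ?h) x = (case x of (l, k) \<Rightarrow> ((2*l - 1) choose (l - 2)) *
      ((2*l - 1 + k) choose k) * ((2*(n - l) - k) choose k) * fact k * a (2 * (n - l - k)))"
      unfolding x(1) comp_def prod.case eqs using x(2) by (simp add: first_occurrence_count_def)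
  qed simp
  also have "\<dots> = (\<Sum>l = 2..n. \<Sum>k = 0..n - l.
      ((2*l - 1) choose (l - 2)) * ((2*l - 1 + k) choose k) * ((2*(n - l) - k) choose k)
      * fact k * a (2 * (n - l - k)))"
    by (subst sum.Sigma) auto
  finally show ?thesis by simp
qed

theorem theorem1:
  fixes \<sigma> \<tau> :: "nat set set" and m n :: nat
  assumes "\<sigma> \<in> {m1212, m1221}"
    and "is_matching m \<tau>"
    and "n \<ge> 2"
  shows "card (avoiders n (2 + m) (juxt 2 \<sigma> \<tau>)) =
    catalan n + (\<Sum>l = 2..n. \<Sum>k = 0..n - l.
      ((2*l - 1) choose (l - 2)) * ((2*l - 1 + k) choose k) * ((2*(n - l) - k) choose k)
      * fact k * card (avoiders (n - l - k) m \<tau>))"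
proof -
  have "card (avoiders n (2 + m) (juxt 2 \<sigma> \<tau>)) =
      card (avoiders_on (2 + m) (juxt 2 \<sigma> \<tau>) {0..<2*n})"
    using avoiders_eq_avoiders_on[OF is_matching_juxt[OF is_matching_sigma[OF assms(1)] assms(2)]]
    by simp
  \<comment> \<open>Matchings avoiding \<open>\<sigma>\<close> contribute \<open>catalan n\<close>;
    the other avoiders are sorted by their first cut.\<close>
  also have "\<dots> = catalan n + (\<Sum>q<2*n. \<Sum>P\<in>Pow {..q}. \<Sum>R\<in>Pow {Suc q..<2*n}.
      card (first_cut_at \<sigma> \<tau> m (2*n) q P R))"
    using card_avoiders_on_juxt_cuts[OF assms(1,2)]
      card_avoiders_on_sigma[OF assms(1), of "{0..<2*n}" n]
    by simp
  also have "(\<Sum>q<2*n. \<Sum>P\<in>Pow {..q}. \<Sum>R\<in>Pow {Suc q..<2*n}.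
      card (first_cut_at \<sigma> \<tau> m (2*n) q P R)) =
    (\<Sum>q<2*n. \<Sum>k\<le>q. (q choose k) * (first_occurrence_count (Suc q - k) *
      (((2*n - Suc q) choose k) * (fact k * card (avoiders_on m \<tau> {0..<2*n - Suc q - k})))))"
    by (intro sum.cong refl sum_card_first_cut_at[OF assms(1,2)]) simp
  also have "\<dots> = (\<Sum>l = 2..n. \<Sum>k = 0..n - l.
      ((2*l - 1) choose (l - 2)) * ((2*l - 1 + k) choose k) * ((2*(n - l) - k) choose k)
      * fact k * card (avoiders_on m \<tau> {0..<2 * (n - l - k)}))"
    by (rule sum_cuts_reindex)
  finally show ?thesis unfolding avoiders_eq_avoiders_on[OF assms(2)] .
qed

end
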